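(* Let $G$ be a graph and let $f$ be a positive integer-valued function on $V(G)$. If for every $S\subseteq V(G)$, $$\tfrac{1}{2}\Omega_2(G\setminus S)\le \sum_{v\in S}\big(f(v)-\tfrac{3}{2}\big)+1+\tfrac{1}{2}\Omega_2(G[S]),$$ then $G$ has a spanning closed trail meeting each vertex $v$ at most $f(v)$ times.
   Context: Graphs are finite, loopless, and may have multiple edges. A graph is $m$-tree-connected if it contains $m$ pairwise edge-disjoint spanning trees (a one-vertex graph is $m$-tree-connected). The $m$-tree-connected components of $G$ are its maximal induced $m$-tree-connected subgraphs; their vertex sets partition $V(G)$. For a partition $P$ of $V(G)$, $e_G(P)$ is the number of edges with ends in different parts. $\Omega_m(G)=m|P|-e_G(P)$ for $P$ the partition into vertex sets of the $m$-tree-connected components (and $\Omega_m=0$ for the graph with no vertices). $G[S]$ is the induced subgraph on $S$ and $G\setminus S$ is obtained by deleting $S$. A spanning closed trail meeting each vertex $v$ at most $f(v)$ times is a closed trail passing through every vertex and through each vertex $v$ at most $f(v)$ times. *)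

theory Defs
  imports Complex_Main
begin

text \<open>A finite loopless multigraph: edges have their own identities, and \<open>ends e\<close> is the set of the
  two end vertices of \<open>e\<close>, so that parallel edges are distinct edges with the same ends.\<close>

record ('a, 'b) mgraph =
  verts :: "'a set"
  edges :: "'b set"
  ends  :: "'b \<Rightarrow> 'a set"

definition multigraph :: "('a, 'b) mgraph \<Rightarrow> bool" where
  "multigraph G \<longleftrightarrow> finite (verts G) \<and> finite (edges G) \<and>
     (\<forall>e\<in>edges G. ends G e \<subseteq> verts G \<and> card (ends G e) = 2)"

definition induced :: "('a, 'b) mgraph \<Rightarrow> 'a set \<Rightarrow> ('a, 'b) mgraph" where
  "induced G S = G\<lparr>verts := verts G \<inter> S, edges := {e \<in> edges G. ends G e \<subseteq> S}\<rparr>"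

definition delete_verts :: "('a, 'b) mgraph \<Rightarrow> 'a set \<Rightarrow> ('a, 'b) mgraph" where
  "delete_verts G S = induced G (verts G - S)"

definition spanning_subgraph :: "('a, 'b) mgraph \<Rightarrow> 'b set \<Rightarrow> ('a, 'b) mgraph" where
  "spanning_subgraph G T = G\<lparr>edges := T\<rparr>"

text \<open>The walk \<open>v\<^sub>0 e\<^sub>1 v\<^sub>1 \<dots> e\<^sub>k v\<^sub>k\<close> is given by its vertex list, of length \<open>k + 1\<close>, and its edge
  list, of length \<open>k\<close>.  The one-vertex walk, with \<open>k = 0\<close>, is allowed, and it is a closed trail.\<close>

definition walk :: "('a, 'b) mgraph \<Rightarrow> 'a list \<Rightarrow> 'b list \<Rightarrow> bool" where
  "walk G vs es \<longleftrightarrow> length vs = length es + 1 \<and> set vs \<subseteq> verts G \<and> set es \<subseteq> edges G \<and>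
     (\<forall>i < length es. ends G (es ! i) = {vs ! i, vs ! Suc i})"

definition closed_trail :: "('a, 'b) mgraph \<Rightarrow> 'a list \<Rightarrow> 'b list \<Rightarrow> bool" where
  "closed_trail G vs es \<longleftrightarrow> walk G vs es \<and> distinct es \<and> hd vs = last vs"

definition cycle :: "('a, 'b) mgraph \<Rightarrow> 'a list \<Rightarrow> 'b list \<Rightarrow> bool" where
  "cycle G vs es \<longleftrightarrow> closed_trail G vs es \<and> es \<noteq> [] \<and> distinct (tl vs)"

definition connected_graph :: "('a, 'b) mgraph \<Rightarrow> bool" where
  "connected_graph G \<longleftrightarrow> verts G \<noteq> {} \<and>
     (\<forall>u\<in>verts G. \<forall>v\<in>verts G. \<exists>vs es. walk G vs es \<and> hd vs = u \<and> last vs = v)"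

definition tree :: "('a, 'b) mgraph \<Rightarrow> bool" where
  "tree G \<longleftrightarrow> connected_graph G \<and> \<not> (\<exists>vs es. cycle G vs es)"

definition spanning_tree :: "('a, 'b) mgraph \<Rightarrow> 'b set \<Rightarrow> bool" where
  "spanning_tree G T \<longleftrightarrow> T \<subseteq> edges G \<and> tree (spanning_subgraph G T)"

text \<open>The trees form an indexed family rather than a set of edge sets, because in a one-vertex
  graph all of them have the empty edge set.\<close>

definition tree_connected :: "nat \<Rightarrow> ('a, 'b) mgraph \<Rightarrow> bool" where
  "tree_connected m G \<longleftrightarrow> (\<exists>T :: nat \<Rightarrow> 'b set.
     (\<forall>i<m. spanning_tree G (T i)) \<and> (\<forall>i<m. \<forall>j<m. i \<noteq> j \<longrightarrow> T i \<inter> T j = {}))"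

definition tree_components :: "nat \<Rightarrow> ('a, 'b) mgraph \<Rightarrow> 'a set set" where
  "tree_components m G = {X. X \<subseteq> verts G \<and> tree_connected m (induced G X) \<and>
     (\<forall>Y. X \<subset> Y \<and> Y \<subseteq> verts G \<longrightarrow> \<not> tree_connected m (induced G Y))}"

definition crossing_edges :: "('a, 'b) mgraph \<Rightarrow> 'a set set \<Rightarrow> nat" where
  "crossing_edges G P = card {e \<in> edges G.
     \<exists>X\<in>P. \<exists>Y\<in>P. X \<noteq> Y \<and> ends G e \<inter> X \<noteq> {} \<and> ends G e \<inter> Y \<noteq> {}}"

text \<open>For \<open>m \<ge> 1\<close> the graph with no vertices has no components, as connected graphs are
  nonempty; so its value is \<open>0\<close>, as the convention demands.\<close>

definition Omega :: "nat \<Rightarrow> ('a, 'b) mgraph \<Rightarrow> int" where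
  "Omega m G = int m * int (card (tree_components m G))
     - int (crossing_edges G (tree_components m G))"

text \<open>The number of times the closed trail with vertex list \<open>vs\<close> meets \<open>v\<close>.  The coinciding first
  and last vertices of a closed trail with at least one edge count as a single visit.\<close>

definition visits :: "'a list \<Rightarrow> 'a \<Rightarrow> nat" where
  "visits vs v = count_list (if length vs = 1 then vs else tl vs) v"

definition spanning_closed_trail :: "('a, 'b) mgraph \<Rightarrow> 'a list \<Rightarrow> 'b list \<Rightarrow> bool" where
  "spanning_closed_trail G vs es \<longleftrightarrow> closed_trail G vs es \<and> set vs = verts G"

end

theory Submission
  imports Defs
begin

text \<open>Call an edge set \<open>F\<close> sparse if every nonempty vertex set \<open>X\<close> spans at most \<open>2|X| - 2\<close> of its edges,
  and \<open>X\<close> tight for \<open>F\<close> in the case of equality.  If \<open>B\<close> is a maximal sparse set inside \<open>U\<close>, then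
  \<open>\<Omega>\<^sub>2(G[U]) = 2|U| - |B|\<close>.  Hence the hypothesis for \<open>S = {}\<close> says that there are sparse \<open>B\<close> for
  which all of \<open>V(G)\<close> is tight.  Choose one minimizing the total excess of its degrees over
  \<open>g = 2 f + 1\<close>.  Let \<open>U\<close> be a maximal set of vertices \<open>w\<close> without excess such that the degree of \<open>w\<close>
  can be pushed below \<open>g w\<close> by changing \<open>B\<close> only inside a tight subset of \<open>U\<close> containing \<open>w\<close>.
  If an edge \<open>xy\<close> with ends in \<open>U\<close> is not spanned by \<open>B\<close> inside \<open>U\<close>, then \<open>x\<close> and \<open>y\<close> can be freed
  independently, and exchanging \<open>xy\<close> for an edge of \<open>B\<close> at a vertex \<open>w\<close> outside \<open>U\<close> either decreases
  the excess or enlarges \<open>U\<close>.  So \<open>B\<close> is maximal sparse inside \<open>U\<close>, and as \<open>S = V(G) - U\<close> has no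
  unsaturated vertices, counting \<open>B\<close>-degrees over \<open>S\<close> contradicts the hypothesis unless the excess
  is \<open>0\<close>.

  The resulting \<open>B\<close> is the union of two disjoint spanning trees.  Adding to the first tree a suitable
  subset of the second one makes all degrees even, hence at most \<open>2 f v\<close>, and an Eulerian trail of
  this subgraph meets \<open>v\<close> at most \<open>f v\<close> times.\<close>

subsection \<open>Sparse edge sets and two disjoint spanning trees\<close>

definition inside :: "('b \<Rightarrow> 'a set) \<Rightarrow> 'b set \<Rightarrow> 'a set \<Rightarrow> 'b set" where
  "inside en F X = {e \<in> F. en e \<subseteq> X}"

definition deg :: "('b \<Rightarrow> 'a set) \<Rightarrow> 'b set \<Rightarrow> 'a \<Rightarrow> nat" where
  "deg en F v = card {e \<in> F. v \<in> en e}"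

text \<open>Equivalently, \<open>F\<close> decomposes into two forests: these are the independent
  sets of the union of two graphic matroids. \<open>X\<close> ranges over all finite sets of the
  type, so that no vertex set has to be carried along. The \<open>+ 2\<close> stands on the left
  because subtraction on naturals is truncated.\<close>

definition sparse :: "('b \<Rightarrow> 'a set) \<Rightarrow> 'b set \<Rightarrow> bool" where
  "sparse en F \<longleftrightarrow> finite F \<and> (\<forall>e\<in>F. card (en e) = 2) \<and>
     (\<forall>X. finite X \<longrightarrow> X \<noteq> {} \<longrightarrow> card (inside en F X) + 2 \<le> 2 * card X)"

definition tight :: "('b \<Rightarrow> 'a set) \<Rightarrow> 'b set \<Rightarrow> 'a set \<Rightarrow> bool" where
  "tight en F X \<longleftrightarrow> finite X \<and> X \<noteq> {} \<and> card (inside en F X) + 2 = 2 * card X"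

text \<open>Connectedness of \<open>X\<close> by edges of \<open>F\<close>, phrased by cuts rather
  than walks, so that adding and removing edges can be checked one cut at a time. The empty set is
  linked vacuously.\<close>

definition linked :: "('b \<Rightarrow> 'a set) \<Rightarrow> 'b set \<Rightarrow> 'a set \<Rightarrow> bool" where
  "linked en F X \<longleftrightarrow> (\<forall>W. W \<subseteq> X \<longrightarrow> W \<noteq> {} \<longrightarrow> W \<noteq> X \<longrightarrow>
     (\<exists>e\<in>F. en e \<inter> W \<noteq> {} \<and> en e \<inter> (X - W) \<noteq> {}))"

lemma finite_inside: "finite F \<Longrightarrow> finite (inside en F X)"
  by (simp add: inside_def)

lemma sparse_finite: "sparse en F \<Longrightarrow> finite F"
  by (simp add: sparse_def)

lemma sparse_card_ends: "sparse en F \<Longrightarrow> e \<in> F \<Longrightarrow> card (en e) = 2"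
  by (simp add: sparse_def)

lemma sparse_card_inside:
  "sparse en F \<Longrightarrow> finite X \<Longrightarrow> X \<noteq> {} \<Longrightarrow> card (inside en F X) + 2 \<le> 2 * card X"
  by (simp add: sparse_def)

lemma sparse_subset:
  assumes "sparse en F" "F' \<subseteq> F"
  shows "sparse en F'"
proof -
  have "card (inside en F' X) \<le> card (inside en F X)" for X
    using assms by (intro card_mono finite_inside) (auto simp: sparse_def inside_def)
  then show ?thesis
    using assms unfolding sparse_def
    by (meson add_le_mono1 finite_subset in_mono le_trans)
qed

lemma linkedE:
  assumes "linked en F X" "W \<subseteq> X" "W \<noteq> {}" "W \<noteq> X"
  obtains e x y where "e \<in> F" "x \<in> en e" "x \<in> W" "y \<in> en e" "y \<in> X" "y \<notin> W"
proof -
  obtain e where "e \<in> F" "en e \<inter> W \<noteq> {}" "en e \<inter> (X - W) \<noteq> {}"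
    using assms unfolding linked_def by blast
  then show ?thesis using that by blast
qed

lemma linked_mono: "linked en F X \<Longrightarrow> F \<subseteq> F' \<Longrightarrow> linked en F' X"
  unfolding linked_def by (meson subsetD)

lemma tight_singleton:
  assumes "\<forall>e\<in>F. card (en e) = 2"
  shows "tight en F {v}"
proof -
  have "inside en F {v} = {}"
  proof -
    have "\<not> en e \<subseteq> {v}" if "e \<in> F" for e
      using card_mono[of "{v}" "en e"] assms that by fastforce
    then show ?thesis by (auto simp: inside_def)
  qed
  then show ?thesis by (simp add: tight_def)
qed

text \<open>An edge inside \<open>X\<close> or \<open>Y\<close> is inside the union, and one inside
  both is inside the intersection. Edges between \<open>X - Y\<close> and \<open>Y - X\<close>
  account for the inequality.\<close>

lemma inside_supermodular:
  assumes "finite F"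
  shows "card (inside en F X) + card (inside en F Y)
    \<le> card (inside en F (X \<union> Y)) + card (inside en F (X \<inter> Y))"
proof -
  have "card (inside en F X) + card (inside en F Y) =
      card (inside en F X \<union> inside en F Y) + card (inside en F X \<inter> inside en F Y)"
    using assms by (intro card_Un_Int finite_inside)
  also have "inside en F X \<inter> inside en F Y = inside en F (X \<inter> Y)"
    by (auto simp: inside_def)
  also have "card (inside en F X \<union> inside en F Y) \<le> card (inside en F (X \<union> Y))"
    using assms by (intro card_mono finite_inside) (auto simp: inside_def)
  finally show ?thesis by simp
qed

text \<open>Uncrossing: \<open>card (inside en F X)\<close> is supermodular and its bound is
  modular, so two equalities force equality at the union and at the intersection. The latter must be
  nonempty for its bound to apply.\<close>

lemma tight_Un_Int:
  assumes "sparse en F" "tight en F X" "tight en F Y" "X \<inter> Y \<noteq> {}"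
  shows "tight en F (X \<union> Y)" "tight en F (X \<inter> Y)"
proof -
  have fin: "finite X" "finite Y" and ne: "X \<noteq> {}" "Y \<noteq> {}"
    and c: "card (inside en F X) + 2 = 2 * card X" "card (inside en F Y) + 2 = 2 * card Y"
    using assms(2,3) by (auto simp: tight_def)
  have "card X + card Y = card (X \<union> Y) + card (X \<inter> Y)"
    using fin by (rule card_Un_Int)
  moreover have "card (inside en F (X \<union> Y)) + 2 \<le> 2 * card (X \<union> Y)"
    "card (inside en F (X \<inter> Y)) + 2 \<le> 2 * card (X \<inter> Y)"
    using sparse_card_inside[OF assms(1)] fin ne assms(4) by auto
  ultimately have "card (inside en F (X \<union> Y)) + 2 = 2 * card (X \<union> Y)"
    "card (inside en F (X \<inter> Y)) + 2 = 2 * card (X \<inter> Y)"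
    using inside_supermodular[OF sparse_finite[OF assms(1)], of en X Y] c by linarith+
  then show "tight en F (X \<union> Y)" "tight en F (X \<inter> Y)"
    using fin ne assms(4) by (auto simp: tight_def)
qed

lemma card_ends_Int:
  assumes "card A = 2" "A \<subseteq> V" "S \<subseteq> V"
  shows "card (A \<inter> S) + (if A \<subseteq> V - S then 1 else 0) = 1 + (if A \<subseteq> S then 1 else 0)"
proof -
  obtain a b where "A = {a, b}" "a \<noteq> b"
    using assms(1) by (meson card_2_iff)
  then show ?thesis using assms(2,3)
    by (cases "a \<in> S"; cases "b \<in> S") auto
qed

text \<open>Double counting: an edge contributes its number of ends in \<open>S\<close>, which is 1,
  plus 1 if it lies inside \<open>S\<close>, minus 1 if it avoids \<open>S\<close>. With
  \<open>S = V\<close> this is the handshake lemma.\<close>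

lemma sum_deg:
  assumes "finite F" "finite S" "S \<subseteq> V" "\<forall>e\<in>F. card (en e) = 2 \<and> en e \<subseteq> V"
  shows "(\<Sum>v\<in>S. deg en F v) + card (inside en F (V - S)) = card F + card (inside en F S)"
proof -
  have "(\<Sum>v\<in>S. deg en F v) = (\<Sum>v\<in>S. \<Sum>e\<in>F. if v \<in> en e then 1 else 0)"
    unfolding deg_def using assms by (simp add: sum.If_cases Int_def)
  also have "\<dots> = (\<Sum>e\<in>F. \<Sum>v\<in>S. if v \<in> en e then 1 else 0)"
    by (rule sum.swap)
  also have "\<dots> = (\<Sum>e\<in>F. card (en e \<inter> S))"
    using assms by (simp add: sum.If_cases Int_def conj_commute)
  finally have 1: "(\<Sum>v\<in>S. deg en F v) = (\<Sum>e\<in>F. card (en e \<inter> S))" .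
  have 2: "card (inside en F X) = (\<Sum>e\<in>F. if en e \<subseteq> X then 1 else 0)" for X
    unfolding inside_def using assms by (simp add: sum.If_cases Int_def)
  have "(\<Sum>e\<in>F. card (en e \<inter> S) + (if en e \<subseteq> V - S then 1 else 0))
      = (\<Sum>e\<in>F. 1 + (if en e \<subseteq> S then 1 else 0))"
    using assms card_ends_Int[of "en _" V S] by (intro sum.cong refl) blast
  then show ?thesis
    unfolding 1 2 sum.distrib by simp
qed

section \<open>Henneberg extensions\<close>

text \<open>Any cut of the larger set either splits \<open>V\<close> or separates \<open>v\<close>
  from all of \<open>V\<close>; the new edge crosses in the second case.\<close>

lemma linked_pendant:
  assumes "linked en T V" "en e = {v, a}" "a \<in> V" "v \<notin> V"
  shows "linked en (insert e T) (insert v V)"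
  unfolding linked_def
proof (intro allI impI)
  fix W assume W: "W \<subseteq> insert v V" "W \<noteq> {}" "W \<noteq> insert v V"
  show "\<exists>e'\<in>insert e T. en e' \<inter> W \<noteq> {} \<and> en e' \<inter> (insert v V - W) \<noteq> {}"
  proof (cases "W \<inter> V \<noteq> {} \<and> W \<inter> V \<noteq> V")
    case True
    then obtain e' where "e' \<in> T" "en e' \<inter> (W \<inter> V) \<noteq> {}" "en e' \<inter> (V - W \<inter> V) \<noteq> {}"
      using assms(1) unfolding linked_def by (meson inf_le2)
    then show ?thesis by blast
  next
    case False
    then have "W = {v} \<or> W = V" using W assms(4) by blast
    then show ?thesis using assms by auto
  qed
qed

text \<open>The edge between \<open>a\<close> and \<open>b\<close>, which carries the name
  \<open>e1\<close> in the modified end map, is subdivided by \<open>v\<close>. A cut separating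
  \<open>a\<close> from \<open>b\<close> is crossed by \<open>e1\<close> or \<open>e2\<close>,
  whichever side \<open>v\<close> is on.\<close>

lemma linked_subdivide:
  assumes "linked (en(e1 := {a, b})) T V" "en e1 = {v, a}" "en e2 = {v, b}"
    "a \<in> V" "b \<in> V" "v \<notin> V"
  shows "linked en (insert e1 (insert e2 T)) (insert v V)"
  unfolding linked_def
proof (intro allI impI)
  fix W assume W: "W \<subseteq> insert v V" "W \<noteq> {}" "W \<noteq> insert v V"
  show "\<exists>e'\<in>insert e1 (insert e2 T). en e' \<inter> W \<noteq> {} \<and> en e' \<inter> (insert v V - W) \<noteq> {}"
  proof (cases "W \<inter> V \<noteq> {} \<and> W \<inter> V \<noteq> V")
    case True
    then obtain e' where e': "e' \<in> T" "(en(e1 := {a, b})) e' \<inter> (W \<inter> V) \<noteq> {}"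
        "(en(e1 := {a, b})) e' \<inter> (V - W \<inter> V) \<noteq> {}"
      using assms(1) unfolding linked_def by (meson inf_le2)
    show ?thesis
    proof (cases "e' = e1")
      case True
      then have "a \<in> W \<and> b \<notin> W \<or> a \<notin> W \<and> b \<in> W" using e' by auto
      then show ?thesis using assms by (cases "v \<in> W") auto
    next
      case False
      then show ?thesis using e' by auto
    qed
  next
    case False
    then have "W = {v} \<or> W = V" using W assms(6) by blast
    then show ?thesis using assms by auto
  qed
qed

lemma other_end:
  assumes "card A = 2" "v \<in> A"
  obtains a where "A = {v, a}" "a \<noteq> v"
  using assms by (metis card_2_iff insert_commute insert_iff singletonD)

text \<open>One more edge can only violate the bound of a set that contains both its ends and was
  already tight. Since \<open>e\<close> is not in \<open>B\<close>, changing its ends does not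
  affect \<open>B\<close>.\<close>

lemma sparse_shortcut:
  assumes sp: "sparse en B" and ab: "a \<noteq> b" "e \<notin> B"
    and nt: "\<And>X. tight en B X \<Longrightarrow> \<not> {a, b} \<subseteq> X"
  shows "sparse (en(e := {a, b})) (insert e B)"
proof -
  let ?en = "en(e := {a, b})"
  have "card (inside ?en (insert e B) X) + 2 \<le> 2 * card X" if X: "finite X" "X \<noteq> {}" for X
  proof -
    have le: "card (inside en B X) + 2 \<le> 2 * card X"
      using sparse_card_inside[OF sp X] .
    have old: "inside ?en B X = inside en B X"
      using ab by (auto simp: inside_def)
    show ?thesis
    proof (cases "{a, b} \<subseteq> X")
      case True
      then have eq: "inside ?en (insert e B) X = insert e (inside en B X)"
        using old by (auto simp: inside_def)
      have "card (inside en B X) + 2 \<noteq> 2 * card X"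
        using nt[of X] True X by (auto simp: tight_def)
      moreover have "card (insert e (inside en B X)) \<le> Suc (card (inside en B X))"
        by (simp add: card_insert_if finite_inside sparse_finite[OF sp])
      ultimately show ?thesis
        unfolding eq using le by linarith
    next
      case False
      then have "inside ?en (insert e B) X = inside en B X"
        using old ab by (auto simp: inside_def)
      then show ?thesis using le by simp
    qed
  qed
  then show ?thesis
    using sp ab unfolding sparse_def by auto
qed

text \<open>Henneberg's inductive construction: a vertex of degree 2 or 3 is removed, in the latter case
  after replacing two of its edges by an edge between their other ends.  The replacement reuses the
  name \<open>e1\<close> of one of the two edges.\<close>

lemma sparse_tight_two_trees:
  fixes en :: "'b \<Rightarrow> 'a set"
  assumes "sparse en B" "tight en B V"
  shows "\<exists>T1 T2. T1 \<subseteq> inside en B V \<and> T2 \<subseteq> inside en B V \<and> T1 \<inter> T2 = {} \<and>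
    linked en T1 V \<and> linked en T2 V"
  using assms
proof (induction "card V" arbitrary: V en B rule: less_induct)
  case less
  have fin: "finite V" "V \<noteq> {}" using less.prems(2) by (auto simp: tight_def)
  show ?case
  proof (cases "card V = 1")
    case True
    then obtain v where "V = {v}" by (meson card_1_singletonE)
    then show ?thesis
      by (intro exI[of _ "{}"]) (auto simp: linked_def)
  next
    case False
    then have cV: "card V \<ge> 2" using fin by (metis One_nat_def card_eq_0_iff less_2_cases not_less)
    define F where "F = inside en B V"
    have spF: "sparse en F"
      using less.prems(1) by (rule sparse_subset) (auto simp: F_def inside_def)
    have finF: "finite F" using spF by (rule sparse_finite)
    have cF: "card F + 2 = 2 * card V" using less.prems(2) by (simp add: F_def tight_def)
    have insF: "\<And>X. X \<subseteq> V \<Longrightarrow> inside en F X = inside en B X"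
      by (auto simp: F_def inside_def)
    have endsF: "\<forall>e\<in>F. card (en e) = 2 \<and> en e \<subseteq> V"
      using sparse_card_ends[OF spF] by (auto simp: F_def inside_def)
    have "inside en F V = F" using endsF by (auto simp: inside_def)
    moreover have "inside en F {} = {}" using endsF by (auto simp: inside_def)
    ultimately have sumd: "(\<Sum>v\<in>V. deg en F v) = 2 * card F"
      using sum_deg[OF finF fin(1) subset_refl endsF] by simp
    \<comment> \<open>The degrees sum to \<open>4 * card V - 4\<close>, so they cannot all be at
      least 4.\<close>
    obtain v where v: "v \<in> V" "deg en F v \<le> 3"
    proof -
      have "\<exists>v\<in>V. deg en F v \<le> 3"
      proof (rule ccontr)
        assume "\<not> ?thesis"
        then have "\<And>v. v \<in> V \<Longrightarrow> 4 \<le> deg en F v" by force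
        then have "4 * card V \<le> (\<Sum>v\<in>V. deg en F v)"
          using sum_bounded_below[of V 4 "deg en F"] by (simp add: mult.commute)
        then show False using sumd cF by linarith
      qed
      then show ?thesis using that by blast
    qed
    define V' where "V' = V - {v}"
    have V': "V = insert v V'" "v \<notin> V'" "finite V'" "card V = Suc (card V')"
      using v fin cV by (auto simp: V'_def card_Diff_singleton)
    have V'ne: "V' \<noteq> {}" using V'(4) cV by auto
    define N where "N = {e \<in> F. v \<in> en e}"
    define F' where "F' = F - N"
    have cN: "card N = deg en F v" by (simp add: N_def deg_def)
    have finN: "finite N" using finF by (simp add: N_def)
    have F': "F' = inside en F V'" using endsF by (auto simp: F'_def N_def inside_def V'_def)
    have cF': "card F = card F' + card N"
      using finF by (simp add: F'_def N_def card_Diff_subset card_mono)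
    have spF': "sparse en F'" using spF by (rule sparse_subset) (simp add: F'_def)
    have insF': "inside en F' V' = F'" using F' by (auto simp: inside_def)
    have F'B: "F' \<subseteq> inside en B V" using F' by (auto simp: F_def inside_def)
    have NB: "N \<subseteq> inside en B V" by (auto simp: N_def F_def)
    have dis: "N \<inter> F' = {}" by (auto simp: F'_def)
    have N_end: "\<exists>a. en e = {v, a} \<and> a \<noteq> v \<and> a \<in> V'" if "e \<in> N" for e
    proof -
      have "card (en e) = 2" "v \<in> en e" using that endsF by (auto simp: N_def)
      then obtain a where "en e = {v, a}" "a \<noteq> v" by (rule other_end)
      then show ?thesis using that endsF by (auto simp: N_def V'_def)
    qed
    \<comment> \<open>As \<open>F\<close> is tight on \<open>V\<close> and its restriction to
      \<open>V'\<close> is sparse, at least two edges end at \<open>v\<close>.\<close>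
    have "card F' + 2 \<le> 2 * card V'"
      using sparse_card_inside[OF spF' V'(3) V'ne] insF' by simp
    then have "card N \<ge> 2" using cF cF' V'(4) by linarith
    then consider "card N = 2" | "card N = 3" using v(2) cN by linarith
    then show ?thesis
    proof cases
      case 1
      then obtain e1 e2 where e: "N = {e1, e2}" "e1 \<noteq> e2" by (meson card_2_iff)
      obtain a where a: "en e1 = {v, a}" "a \<in> V'" using N_end e by blast
      obtain b where b: "en e2 = {v, b}" "b \<in> V'" using N_end e by blast
      have "tight en F' V'" using 1 cF cF' V' V'ne insF' by (simp add: tight_def)
      then obtain T1 T2 where T: "T1 \<subseteq> F'" "T2 \<subseteq> F'" "T1 \<inter> T2 = {}"
          "linked en T1 V'" "linked en T2 V'"
        using less.hyps[OF _ spF', of V'] V' insF' by auto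
      show ?thesis
      proof (intro exI conjI)
        show "insert e1 T1 \<subseteq> inside en B V" "insert e2 T2 \<subseteq> inside en B V"
          using T F'B NB e by auto
        show "insert e1 T1 \<inter> insert e2 T2 = {}" using T e dis by auto
        show "linked en (insert e1 T1) V" "linked en (insert e2 T2) V"
          unfolding V'(1) using linked_pendant T a b V'(2) by metis+
      qed
    next
      case 2
      define joined where "joined = (\<lambda>e e'. \<exists>X. tight en F' X \<and> en e \<union> en e' - {v} \<subseteq> X)"
      \<comment> \<open>A tight set containing the other ends of all three edges would, after adding
        the single vertex \<open>v\<close>, span three more edges, one more than sparsity
        allows.\<close>
      have not_all: "\<not> (\<exists>X. tight en F' X \<and> \<Union>(en ` N) - {v} \<subseteq> X)"
      proof
        assume "\<exists>X. tight en F' X \<and> \<Union>(en ` N) - {v} \<subseteq> X"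
        then obtain X where X: "tight en F' X" "\<Union>(en ` N) - {v} \<subseteq> X" by blast
        have finX: "finite X" and cX: "card (inside en F' X) + 2 = 2 * card X"
          using X(1) by (auto simp: tight_def)
        have "inside en F' X \<union> N \<subseteq> inside en F (insert v X)"
          using X(2) by (auto simp: inside_def F'_def N_def)
        then have "card (inside en F' X \<union> N) \<le> card (inside en F (insert v X))"
          by (intro card_mono finite_inside finF)
        moreover have "card (inside en F' X \<union> N) = card (inside en F' X) + 3"
        proof -
          have "inside en F' X \<inter> N = {}" using dis by (auto simp: inside_def)
          then show ?thesis
            using 2 card_Un_disjoint[OF finite_inside[OF sparse_finite[OF spF']] finN] by simp
        qed
        moreover have "card (inside en F (insert v X)) + 2 \<le> 2 * card (insert v X)"
          using sparse_card_inside[OF spF] finX by simp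
        moreover have "card (insert v X) \<le> Suc (card X)" by (simp add: card_insert_le_m1 card_insert_if finX)
        ultimately show False using cX by linarith
      qed
      obtain e1 e2 e3 where e: "N = {e1, e2, e3}" "e1 \<noteq> e2" "e2 \<noteq> e3" "e1 \<noteq> e3" "\<not> joined e1 e2"
      proof -
        obtain e1 e2 e3 where e: "N = {e1, e2, e3}" "e1 \<noteq> e2" "e2 \<noteq> e3" "e1 \<noteq> e3"
          using 2 by (auto simp: card_3_iff)
        \<comment> \<open>Two such tight sets share the other end of \<open>e2\<close>, so their
          union would be tight and contradict \<open>not_all\<close>. Hence one of the two pairs can
          be shortcut.\<close>
        have "\<not> (joined e1 e2 \<and> joined e2 e3)"
        proof
          assume "joined e1 e2 \<and> joined e2 e3"
          then obtain X Y where X: "tight en F' X" "en e1 \<union> en e2 - {v} \<subseteq> X"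
            and Y: "tight en F' Y" "en e2 \<union> en e3 - {v} \<subseteq> Y"
            unfolding joined_def by blast
          obtain b where "en e2 = {v, b}" "b \<noteq> v" using N_end e by blast
          then have "X \<inter> Y \<noteq> {}" using X Y by blast
          then have "tight en F' (X \<union> Y)" using tight_Un_Int(1)[OF spF' X(1) Y(1)] by blast
          moreover have "\<Union>(en ` N) - {v} \<subseteq> X \<union> Y" using X Y e by auto
          ultimately show False using not_all by blast
        qed
        then show ?thesis
          using that[of e1 e2 e3] that[of e2 e3 e1] e by (auto simp: insert_commute)
      qed
      obtain a where a: "en e1 = {v, a}" "a \<noteq> v" "a \<in> V'" using N_end e by blast
      obtain b where b: "en e2 = {v, b}" "b \<noteq> v" "b \<in> V'" using N_end e by blast
      obtain c where c: "en e3 = {v, c}" "c \<noteq> v" "c \<in> V'" using N_end e by blast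
      have nt: "\<not> {a, b} \<subseteq> X" if "tight en F' X" for X
        using e(5) that a b unfolding joined_def by auto
      \<comment> \<open>Singletons are tight, so \<open>nt\<close> also excludes that the shortcut
        is a loop.\<close>
      have "a \<noteq> b"
        using nt[OF tight_singleton, of a] sparse_card_ends[OF spF'] by auto
      define en' where "en' = en(e1 := {a, b})"
      have e1F': "e1 \<notin> F'" using e dis by auto
      have sp': "sparse en' (insert e1 F')"
        unfolding en'_def using spF' \<open>a \<noteq> b\<close> e1F' nt by (rule sparse_shortcut)
      have ins': "inside en' (insert e1 F') V' = insert e1 F'"
      proof -
        have "en e \<subseteq> V'" if "e \<in> F'" for e using that F' by (simp add: inside_def)
        then show ?thesis using a b e1F' by (auto simp: inside_def en'_def)
      qed
      have "tight en' (insert e1 F') V'"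
        using 2 cF cF' V' V'ne e1F' sparse_finite[OF spF'] by (simp add: tight_def ins')
      then obtain S1 S2 where S: "S1 \<subseteq> insert e1 F'" "S2 \<subseteq> insert e1 F'" "S1 \<inter> S2 = {}"
          "linked en' S1 V'" "linked en' S2 V'"
        using less.hyps[OF _ sp', of V'] V' ins' by auto
      \<comment> \<open>The two sets are named so that \<open>T2\<close> avoids the artificial edge
        \<open>e1\<close>. Subdividing then extends \<open>T1\<close> by \<open>e1\<close> and
        \<open>e2\<close>, and \<open>e3\<close> becomes pendant in \<open>T2\<close>.\<close>
      obtain T1 T2 where T: "T1 \<subseteq> insert e1 F'" "T2 \<subseteq> F'" "T1 \<inter> T2 = {}"
          "linked en' T1 V'" "linked en' T2 V'"
      proof (cases "e1 \<in> S2")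
        case True
        then show ?thesis using S by (intro that[of S2 S1]) auto
      next
        case False
        then show ?thesis using S by (intro that[of S1 S2]) auto
      qed
      have "linked en T2 V'"
      proof -
        have "en' e = en e" if "e \<in> T2" for e using that T(2) e1F' by (auto simp: en'_def)
        then show ?thesis using T(5) by (simp add: linked_def)
      qed
      show ?thesis
      proof (intro exI conjI)
        show "insert e1 (insert e2 T1) \<subseteq> inside en B V" "insert e3 T2 \<subseteq> inside en B V"
          using T F'B NB e by auto
        show "insert e1 (insert e2 T1) \<inter> insert e3 T2 = {}" using T e dis e1F' by auto
        show "linked en (insert e1 (insert e2 T1)) V"
          unfolding V'(1) using linked_subdivide[OF T(4)[unfolded en'_def]] a b V'(2) by metis
        show "linked en (insert e3 T2) V"
          unfolding V'(1) using linked_pendant \<open>linked en T2 V'\<close> c V'(2) by metis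
      qed
    qed
  qed
qed

subsection \<open>Tree-connected components\<close>

lemma walk_crosses:
  assumes "walk H vs es" "hd vs \<in> W" "last vs \<notin> W"
  shows "\<exists>i<length es. vs ! i \<in> W \<and> vs ! Suc i \<notin> W"
proof (rule ccontr)
  assume "\<not> ?thesis"
  then have step: "\<And>i. i < length es \<Longrightarrow> vs ! i \<in> W \<Longrightarrow> vs ! Suc i \<in> W" by blast
  have len: "length vs = length es + 1" using assms(1) by (simp add: walk_def)
  then have "vs \<noteq> []" by auto
  have "vs ! i \<in> W" if "i \<le> length es" for i
    using that
  proof (induction i)
    case 0
    then show ?case using assms(2) \<open>vs \<noteq> []\<close> by (simp add: hd_conv_nth)
  next
    case (Suc i)
    then show ?case using step[of i] by simp
  qed
  then show False using assms(3) len \<open>vs \<noteq> []\<close> by (simp add: last_conv_nth)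
qed

lemma connected_graph_linked:
  assumes "connected_graph (spanning_subgraph H T)"
  shows "linked (ends H) T (verts H)"
  unfolding linked_def
proof (intro allI impI)
  fix W assume W: "W \<subseteq> verts H" "W \<noteq> {}" "W \<noteq> verts H"
  then obtain u v where uv: "u \<in> W" "v \<in> verts H" "v \<notin> W" by blast
  then have "u \<in> verts (spanning_subgraph H T)" "v \<in> verts (spanning_subgraph H T)"
    using W(1) by (auto simp: spanning_subgraph_def)
  then obtain vs es where w: "walk (spanning_subgraph H T) vs es" "hd vs = u" "last vs = v"
    using assms unfolding connected_graph_def by blast
  then obtain i where i: "i < length es" "vs ! i \<in> W" "vs ! Suc i \<notin> W"
    using walk_crosses[OF w(1)] uv by blast
  have "vs ! Suc i \<in> set vs" using i w(1) by (simp add: walk_def)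
  then have "vs ! Suc i \<in> verts H" using w(1) by (auto simp: walk_def spanning_subgraph_def)
  moreover have "es ! i \<in> T" "ends H (es ! i) = {vs ! i, vs ! Suc i}"
    using w(1) i by (auto simp: walk_def spanning_subgraph_def)
  ultimately show "\<exists>e\<in>T. ends H e \<inter> W \<noteq> {} \<and> ends H e \<inter> (verts H - W) \<noteq> {}"
    using i by (intro bexI[of _ "es ! i"]) auto
qed

lemma walk_snoc:
  assumes "walk H vs es" "e \<in> edges H" "ends H e = {last vs, w}" "w \<in> verts H"
  shows "walk H (vs @ [w]) (es @ [e])"
proof -
  have "length vs = length es + 1" using assms(1) by (simp add: walk_def)
  moreover from this have "last vs = vs ! length es" by (simp add: last_conv_nth flip: length_greater_0_conv)
  ultimately show ?thesis using assms
    by (auto simp: walk_def nth_append less_Suc_eq)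
qed

text \<open>The set of vertices reachable from \<open>u\<close> cannot be left along an edge of
  \<open>T\<close>, so by linking it is everything.\<close>

lemma linked_connected_graph:
  assumes "multigraph H" "T \<subseteq> edges H" "verts H \<noteq> {}" "linked (ends H) T (verts H)"
  shows "connected_graph (spanning_subgraph H T)"
proof -
  let ?K = "spanning_subgraph H T"
  have "\<exists>vs es. walk ?K vs es \<and> hd vs = u \<and> last vs = v" if u: "u \<in> verts H" and v: "v \<in> verts H" for u v
  proof -
    define R where "R = {v \<in> verts H. \<exists>vs es. walk ?K vs es \<and> hd vs = u \<and> last vs = v}"
    have "walk ?K [u] []" using u by (simp add: walk_def spanning_subgraph_def)
    then have "u \<in> R" unfolding R_def using u by fastforce
    have "R = verts H"
    proof (rule ccontr)
      assume "R \<noteq> verts H"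
      moreover have "R \<subseteq> verts H" by (auto simp: R_def)
      moreover have "R \<noteq> {}" using \<open>u \<in> R\<close> by blast
      ultimately obtain e x y where e: "e \<in> T" and xy: "x \<in> ends H e" "x \<in> R" "y \<in> ends H e"
          "y \<in> verts H" "y \<notin> R"
        using linkedE[OF assms(4)] by metis
      have "card (ends H e) = 2" using assms(1,2) e by (auto simp: multigraph_def)
      then obtain z where z: "ends H e = {x, z}" using xy(1) by (rule other_end)
      moreover have "y \<noteq> x" using xy by blast
      ultimately have ee: "ends H e = {x, y}" using xy(3) by auto
      obtain vs es where w: "walk ?K vs es" "hd vs = u" "last vs = x" using xy(2) by (auto simp: R_def)
      have "walk ?K (vs @ [y]) (es @ [e])"
        using walk_snoc[OF w(1), of e y] w(3) e ee xy(4) by (simp add: spanning_subgraph_def)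
      moreover have "hd (vs @ [y]) = u"
        using w(1,2) by (cases vs) (auto simp: walk_def)
      moreover have "last (vs @ [y]) = y" by simp
      ultimately have "\<exists>vs es. walk ?K vs es \<and> hd vs = u \<and> last vs = y" by metis
      then have "y \<in> R" using xy(4) unfolding R_def by simp
      then show False using xy(5) by blast
    qed
    then show ?thesis using v by (auto simp: R_def)
  qed
  then show ?thesis using assms(3) by (auto simp: connected_graph_def spanning_subgraph_def)
qed

text \<open>If the first edge of a cycle crosses a cut, the rest of the cycle has to cross back, and
  it does so along a different edge.\<close>

lemma linked_remove_cycle_edge:
  assumes c: "cycle (spanning_subgraph H T) vs es" and "linked (ends H) T (verts H)"
  shows "linked (ends H) (T - {es ! 0}) (verts H)"
  unfolding linked_def
proof (intro allI impI)
  fix W assume W: "W \<subseteq> verts H" "W \<noteq> {}" "W \<noteq> verts H"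
  have w: "length vs = length es + 1" "set vs \<subseteq> verts H" "set es \<subseteq> T"
      "\<And>i. i < length es \<Longrightarrow> ends H (es ! i) = {vs ! i, vs ! Suc i}"
      "distinct es" "hd vs = last vs" "es \<noteq> []"
    using c by (auto simp: cycle_def closed_trail_def walk_def spanning_subgraph_def)
  have vsV: "vs ! i \<in> verts H" if "i \<le> length es" for i
    using that w(1,2) by (metis Suc_eq_plus1 less_Suc_eq_le nth_mem subsetD)
  obtain e where e: "e \<in> T" "ends H e \<inter> W \<noteq> {}" "ends H e \<inter> (verts H - W) \<noteq> {}"
    using assms(2) W unfolding linked_def by blast
  show "\<exists>e\<in>T - {es ! 0}. ends H e \<inter> W \<noteq> {} \<and> ends H e \<inter> (verts H - W) \<noteq> {}"
  proof (cases "e = es ! 0")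
    case False
    then show ?thesis using e by auto
  next
    case True
    have "ends H e = {vs ! 0, vs ! 1}" using True w(4)[of 0] w(7) by simp
    then have ne: "(vs ! 0 \<in> W) \<noteq> (vs ! 1 \<in> W)" using e(2,3) by auto
    have "\<exists>i<length es. 0 < i \<and> (vs ! i \<in> W) \<noteq> (vs ! Suc i \<in> W)"
    proof (rule ccontr)
      assume "\<not> ?thesis"
      then have step: "\<And>i. 0 < i \<Longrightarrow> i < length es \<Longrightarrow> (vs ! Suc i \<in> W) = (vs ! i \<in> W)" by blast
      have "(vs ! Suc i \<in> W) = (vs ! 1 \<in> W)" if "i < length es" for i
        using that
      proof (induction i)
        case 0
        then show ?case by simp
      next
        case (Suc i)
        then show ?case using step[of "Suc i"] by simp
      qed
      from this[of "length es - 1"] have "(last vs \<in> W) = (vs ! 1 \<in> W)"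
        using w(1,7) by (cases "vs = []") (auto simp: last_conv_nth)
      moreover have "hd vs = vs ! 0" using w(1) by (intro hd_conv_nth) auto
      ultimately show False using ne w(6) by simp
    qed
    then obtain i where i: "i < length es" "0 < i" "(vs ! i \<in> W) \<noteq> (vs ! Suc i \<in> W)" by blast
    have "es ! i \<in> T" using i(1) w(3) nth_mem by blast
    moreover have "es ! i \<noteq> es ! 0" using i w(5,7) by (simp add: nth_eq_iff_index_eq)
    moreover have "vs ! i \<in> verts H" "vs ! Suc i \<in> verts H" using vsV i(1) by auto
    ultimately show ?thesis using i(3) w(4)[OF i(1)]
      by (intro bexI[of _ "es ! i"]) auto
  qed
qed

text \<open>A linking subset of least size contains no cycle, because a cycle edge could be
  removed.\<close>

lemma linked_spanning_tree:
  assumes "multigraph H" "T \<subseteq> edges H" "verts H \<noteq> {}" "linked (ends H) T (verts H)"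
  shows "\<exists>T'\<subseteq>T. spanning_tree H T'"
proof -
  define T' where "T' = (ARG_MIN card T'. T' \<subseteq> T \<and> linked (ends H) T' (verts H))"
  have T': "T' \<subseteq> T" "linked (ends H) T' (verts H)"
    and min: "\<And>T''. T'' \<subseteq> T \<Longrightarrow> linked (ends H) T'' (verts H) \<Longrightarrow> card T' \<le> card T''"
    using arg_min_nat_lemma[of "\<lambda>T'. T' \<subseteq> T \<and> linked (ends H) T' (verts H)" T card] assms(4)
    unfolding T'_def by auto
  have "finite T'" using assms(1,2) T'(1) by (meson finite_subset multigraph_def)
  have "\<not> cycle (spanning_subgraph H T') vs es" for vs es
  proof
    assume c: "cycle (spanning_subgraph H T') vs es"
    then have "es ! 0 \<in> T'"
      by (auto simp: cycle_def closed_trail_def walk_def spanning_subgraph_def)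
    then have "card (T' - {es ! 0}) < card T'"
      using \<open>finite T'\<close> by (intro psubset_card_mono) auto
    then show False
      using min[of "T' - {es ! 0}"] T' linked_remove_cycle_edge[OF c T'(2)] by auto
  qed
  moreover have "connected_graph (spanning_subgraph H T')"
    using linked_connected_graph[OF assms(1) _ assms(3) T'(2)] T'(1) assms(2) by blast
  ultimately have "spanning_tree H T'"
    using T'(1) assms(2) by (auto simp: spanning_tree_def tree_def)
  then show ?thesis using T'(1) by blast
qed

text \<open>Linking sets take the place of spanning trees: they need not be acyclic, which makes
  unions easy, and trees can be extracted from them afterwards.\<close>

definition twofold_linked :: "('b \<Rightarrow> 'a set) \<Rightarrow> 'b set \<Rightarrow> 'a set \<Rightarrow> bool" where
  "twofold_linked en F X \<longleftrightarrow> (\<exists>T1 T2. T1 \<subseteq> F \<and> T2 \<subseteq> F \<and> T1 \<inter> T2 = {} \<and>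
     linked en T1 X \<and> linked en T2 X)"

lemma tree_connected_2_iff:
  assumes "multigraph H"
  shows "tree_connected 2 H \<longleftrightarrow> verts H \<noteq> {} \<and> twofold_linked (ends H) (edges H) (verts H)"
proof
  assume "tree_connected 2 H"
  then obtain T :: "nat \<Rightarrow> 'b set" where T: "\<forall>i<2. spanning_tree H (T i)"
      "\<forall>i<2. \<forall>j<2. i \<noteq> j \<longrightarrow> T i \<inter> T j = {}"
    unfolding tree_connected_def by blast
  have "spanning_tree H (T 0)" "spanning_tree H (T 1)" "T 0 \<inter> T 1 = {}" using T by auto
  then show "verts H \<noteq> {} \<and> twofold_linked (ends H) (edges H) (verts H)"
    unfolding twofold_linked_def spanning_tree_def tree_def
    using connected_graph_linked[of H] by (metis connected_graph_def spanning_subgraph_def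
      mgraph.select_convs(1) mgraph.surjective mgraph.update_convs(2))
next
  assume R: "verts H \<noteq> {} \<and> twofold_linked (ends H) (edges H) (verts H)"
  then obtain T1 T2 where T: "T1 \<subseteq> edges H" "T2 \<subseteq> edges H" "T1 \<inter> T2 = {}"
      "linked (ends H) T1 (verts H)" "linked (ends H) T2 (verts H)"
    unfolding twofold_linked_def by blast
  obtain S1 where S1: "S1 \<subseteq> T1" "spanning_tree H S1"
    using linked_spanning_tree[OF assms T(1) _ T(4)] R by blast
  obtain S2 where S2: "S2 \<subseteq> T2" "spanning_tree H S2"
    using linked_spanning_tree[OF assms T(2) _ T(5)] R by blast
  show "tree_connected 2 H"
    unfolding tree_connected_def
    using S1 S2 T(3) by (intro exI[of _ "\<lambda>i. if i = 0 then S1 else S2"]) auto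
qed

text \<open>The edges of \<open>T'\<close> inside \<open>X\<close> are dropped so that, when two
  disjoint pairs of linking sets are merged, the results stay disjoint. Linking survives because
  \<open>X\<close> is already linked by \<open>T\<close> and acts like a single vertex.\<close>

lemma linked_Un:
  assumes "linked en T X" "linked en T' Y" "X \<inter> Y \<noteq> {}"
  shows "linked en (T \<union> {e \<in> T'. \<not> en e \<subseteq> X}) (X \<union> Y)"
proof -
  let ?T = "T \<union> {e \<in> T'. \<not> en e \<subseteq> X}"
  have out: "\<exists>e\<in>?T. en e \<inter> W \<noteq> {} \<and> en e \<inter> (X \<union> Y - W) \<noteq> {}"
    if W: "W \<subseteq> Y" "W \<noteq> {}" "X \<inter> W = {}" for W
  proof -
    have "W \<noteq> Y" using W assms(3) by blast
    then obtain e x y where "e \<in> T'" "x \<in> en e" "x \<in> W" "y \<in> en e" "y \<in> Y" "y \<notin> W"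
      using linkedE[OF assms(2) W(1,2)] by metis
    then show ?thesis using W(3) by (intro bexI[of _ e]) auto
  qed
  show ?thesis
    unfolding linked_def
  proof (intro allI impI)
    fix W assume W: "W \<subseteq> X \<union> Y" "W \<noteq> {}" "W \<noteq> X \<union> Y"
    consider "X \<inter> W = {}" | "X \<subseteq> W" | "X \<inter> W \<noteq> {}" "X \<inter> W \<noteq> X" by blast
    then show "\<exists>e\<in>?T. en e \<inter> W \<noteq> {} \<and> en e \<inter> (X \<union> Y - W) \<noteq> {}"
    proof cases
      case 1
      then show ?thesis using out[of W] W by auto
    next
      \<comment> \<open>The complement of \<open>W\<close> avoids \<open>X\<close>, and crossing is
        symmetric, so \<open>out\<close> applies to the complement.\<close>
      case 2
      have "X \<union> Y - (X \<union> Y - W) = W" using W(1) by auto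
      moreover have "X \<union> Y - W \<subseteq> Y" "X \<inter> (X \<union> Y - W) = {}" "X \<union> Y - W \<noteq> {}"
        using 2 W(1,3) by auto
      ultimately show ?thesis using out[of "X \<union> Y - W"] by auto
    next
      case 3
      then obtain e x y where "e \<in> T" "x \<in> en e" "x \<in> X \<inter> W" "y \<in> en e" "y \<in> X" "y \<notin> X \<inter> W"
        using linkedE[OF assms(1), of "X \<inter> W"] by blast
      then show ?thesis by (intro bexI[of _ e]) auto
    qed
  qed
qed

lemma twofold_linked_Un:
  assumes "twofold_linked en (inside en F X) X" "twofold_linked en (inside en F Y) Y" "X \<inter> Y \<noteq> {}"
  shows "twofold_linked en (inside en F (X \<union> Y)) (X \<union> Y)"
proof -
  obtain T1 T2 where T: "T1 \<subseteq> inside en F X" "T2 \<subseteq> inside en F X" "T1 \<inter> T2 = {}"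
      "linked en T1 X" "linked en T2 X"
    using assms(1) unfolding twofold_linked_def by blast
  obtain S1 S2 where S: "S1 \<subseteq> inside en F Y" "S2 \<subseteq> inside en F Y" "S1 \<inter> S2 = {}"
      "linked en S1 Y" "linked en S2 Y"
    using assms(2) unfolding twofold_linked_def by blast
  have "linked en (T1 \<union> {e \<in> S1. \<not> en e \<subseteq> X}) (X \<union> Y)" "linked en (T2 \<union> {e \<in> S2. \<not> en e \<subseteq> X}) (X \<union> Y)"
    using linked_Un T S assms(3) by blast+
  moreover have "(T1 \<union> {e \<in> S1. \<not> en e \<subseteq> X}) \<inter> (T2 \<union> {e \<in> S2. \<not> en e \<subseteq> X}) = {}"
    using T(1,2,3) S(3) by (auto simp: inside_def)
  moreover have "T1 \<union> {e \<in> S1. \<not> en e \<subseteq> X} \<subseteq> inside en F (X \<union> Y)"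
      "T2 \<union> {e \<in> S2. \<not> en e \<subseteq> X} \<subseteq> inside en F (X \<union> Y)"
    using T(1,2) S(1,2) by (auto simp: inside_def)
  ultimately show ?thesis unfolding twofold_linked_def by blast
qed


section \<open>Partitions into maximal sets and their crossing edges\<close>

text \<open>The predicate is a parameter because two partitions of this kind occur: into maximal
  tight sets, and into components.\<close>

definition maximal_parts :: "('a set \<Rightarrow> bool) \<Rightarrow> 'a set \<Rightarrow> 'a set set" where
  "maximal_parts \<Phi> U = {X. X \<subseteq> U \<and> \<Phi> X \<and> (\<forall>Y. X \<subset> Y \<and> Y \<subseteq> U \<longrightarrow> \<not> \<Phi> Y)}"

lemma maximal_parts_above:
  assumes "finite U" "X \<subseteq> U" "\<Phi> X"
  shows "\<exists>Y\<in>maximal_parts \<Phi> U. X \<subseteq> Y"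
proof -
  have "finite {Y. Y \<subseteq> U \<and> \<Phi> Y}" using assms(1) by simp
  moreover have "X \<in> {Y. Y \<subseteq> U \<and> \<Phi> Y}" using assms by simp
  ultimately obtain Y where Y: "Y \<in> {Y. Y \<subseteq> U \<and> \<Phi> Y}" "X \<subseteq> Y"
      "\<forall>Z\<in>{Y. Y \<subseteq> U \<and> \<Phi> Y}. Y \<subseteq> Z \<longrightarrow> Z = Y"
    by (metis (no_types, lifting) finite_has_maximal2)
  then show ?thesis unfolding maximal_parts_def by blast
qed

lemma maximal_parts_disjoint:
  assumes "\<And>X Y. X \<subseteq> U \<Longrightarrow> Y \<subseteq> U \<Longrightarrow> \<Phi> X \<Longrightarrow> \<Phi> Y \<Longrightarrow> X \<inter> Y \<noteq> {} \<Longrightarrow> \<Phi> (X \<union> Y)"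
    and "X \<in> maximal_parts \<Phi> U" "Y \<in> maximal_parts \<Phi> U" "X \<noteq> Y"
  shows "X \<inter> Y = {}"
proof (rule ccontr)
  assume "X \<inter> Y \<noteq> {}"
  then have U: "\<Phi> (X \<union> Y)" "X \<union> Y \<subseteq> U"
    using assms(1)[of X Y] assms(2,3) by (simp_all add: maximal_parts_def)
  consider "X \<subset> X \<union> Y" | "Y \<subset> X \<union> Y" using assms(4) by blast
  then show False using U assms(2,3) by cases (auto simp: maximal_parts_def)
qed

definition partitions :: "'a set set \<Rightarrow> 'a set \<Rightarrow> bool" where
  "partitions P U \<longleftrightarrow> finite U \<and> \<Union>P = U \<and> {} \<notin> P \<and> (\<forall>X\<in>P. \<forall>Y\<in>P. X \<noteq> Y \<longrightarrow> X \<inter> Y = {})"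

lemma partitions_maximal_parts:
  assumes "finite U" "\<And>v. v \<in> U \<Longrightarrow> \<Phi> {v}" "\<not> \<Phi> {}"
    and "\<And>X Y. X \<subseteq> U \<Longrightarrow> Y \<subseteq> U \<Longrightarrow> \<Phi> X \<Longrightarrow> \<Phi> Y \<Longrightarrow> X \<inter> Y \<noteq> {} \<Longrightarrow> \<Phi> (X \<union> Y)"
  shows "partitions (maximal_parts \<Phi> U) U"
proof -
  have "v \<in> \<Union>(maximal_parts \<Phi> U)" if "v \<in> U" for v
    using maximal_parts_above[OF assms(1), of "{v}" \<Phi>] assms(2) that by auto
  moreover have "X \<inter> Y = {}"
    if "X \<in> maximal_parts \<Phi> U" "Y \<in> maximal_parts \<Phi> U" "X \<noteq> Y" for X Y
    by (rule maximal_parts_disjoint[where \<Phi> = \<Phi> and U = U, OF _ that]) (rule assms(4))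
  moreover have "\<Union>(maximal_parts \<Phi> U) \<subseteq> U" "{} \<notin> maximal_parts \<Phi> U"
    using assms(3) by (auto simp: maximal_parts_def)
  ultimately show ?thesis
    using assms(1) unfolding partitions_def by blast
qed

lemma partitions_finite:
  assumes "partitions P U" shows "finite P" "X \<in> P \<Longrightarrow> finite X"
proof -
  have U: "finite (\<Union>P)" using assms by (simp add: partitions_def)
  show "finite P" using U by (rule finite_UnionD)
  show "finite X" if "X \<in> P" using U that by (meson Union_upper finite_subset)
qed

text \<open>For edges whose two ends are covered by a partition \<open>P\<close>, this agrees with
  having ends in different parts.\<close>

definition crossing :: "('b \<Rightarrow> 'a set) \<Rightarrow> 'b set \<Rightarrow> 'a set set \<Rightarrow> 'b set" where
  "crossing en F P = {e \<in> F. \<forall>X\<in>P. \<not> en e \<subseteq> X}"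

lemma sum_card_partitions:
  assumes "partitions P U" shows "(\<Sum>X\<in>P. card X) = card U"
proof -
  have "pairwise disjnt P" using assms by (simp add: partitions_def pairwise_def disjnt_def)
  then have "card (\<Union>P) = (\<Sum>X\<in>P. card X)"
    using partitions_finite(2)[OF assms] by (rule card_Union_disjoint)
  then show ?thesis using assms by (simp add: partitions_def)
qed

lemma card_crossing:
  assumes "partitions P U" "finite F" "\<forall>e\<in>F. en e \<noteq> {}"
  shows "card F = card (crossing en F P) + (\<Sum>X\<in>P. card (inside en F X))"
proof -
  have "card (\<Union>X\<in>P. inside en F X) = (\<Sum>X\<in>P. card (inside en F X))"
  proof (rule card_UN_disjoint)
    show "finite P" using partitions_finite[OF assms(1)] by simp
    show "\<forall>X\<in>P. finite (inside en F X)" using assms(2) by (simp add: finite_inside)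
    show "\<forall>X\<in>P. \<forall>Y\<in>P. X \<noteq> Y \<longrightarrow> inside en F X \<inter> inside en F Y = {}"
    proof (intro ballI impI)
      fix X Y assume "X \<in> P" "Y \<in> P" "X \<noteq> Y"
      then have "X \<inter> Y = {}" using assms(1) by (simp add: partitions_def)
      then show "inside en F X \<inter> inside en F Y = {}" using assms(3) by (force simp: inside_def)
    qed
  qed
  moreover have "F = crossing en F P \<union> (\<Union>X\<in>P. inside en F X)"
    by (auto simp: crossing_def inside_def)
  moreover have "crossing en F P \<inter> (\<Union>X\<in>P. inside en F X) = {}"
    by (auto simp: crossing_def inside_def)
  ultimately show ?thesis
    using assms(2) by (metis card_Un_disjoint finite_Un)
qed

text \<open>Contracting every part leaves a connected graph on \<open>card P\<close> vertices, which
  has at least \<open>card P - 1\<close> edges. The induction contracts one crossing edge at a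
  time.\<close>

lemma card_crossing_linked:
  assumes "linked en T U" "partitions P U" "finite T" "\<forall>e\<in>T. card (en e) = 2"
  shows "card P \<le> card (crossing en T P) + 1"
  using assms(2)
proof (induction "card P" arbitrary: P rule: less_induct)
  case less
  have finP: "finite P" using partitions_finite[OF less.prems] by simp
  show ?case
  proof (cases "card P \<le> 1")
    case False
    then have "P \<noteq> {}" by auto
    then obtain A where A: "A \<in> P" by blast
    have "P \<noteq> {A}" using False by auto
    then obtain A' where A': "A' \<in> P" "A' \<noteq> A" using A by blast
    have UP: "\<Union>P = U" and ne: "\<And>X. X \<in> P \<Longrightarrow> X \<noteq> {}"
      and dis: "\<And>X Y. X \<in> P \<Longrightarrow> Y \<in> P \<Longrightarrow> X \<noteq> Y \<Longrightarrow> X \<inter> Y = {}"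
      using less.prems by (auto simp: partitions_def)
    have "A \<noteq> {}" using ne A by simp
    have "A \<subseteq> U" using UP A by blast
    have "A \<noteq> U"
      using UP A' ne[OF A'(1)] dis[OF A'(1) A A'(2)] by blast
    then obtain e where e: "e \<in> T" "en e \<inter> A \<noteq> {}" "en e \<inter> (U - A) \<noteq> {}"
      using assms(1) \<open>A \<subseteq> U\<close> \<open>A \<noteq> {}\<close> unfolding linked_def by blast
    then obtain y where y: "y \<in> en e" "y \<in> U" "y \<notin> A" by blast
    then obtain C where C: "C \<in> P" "y \<in> C" using UP by blast
    have CA: "C \<noteq> A" using C y by blast
    obtain x where x: "x \<in> en e" "x \<in> A" using e(2) by blast
    have AC: "A \<inter> C = {}" "C \<noteq> {}" using dis[OF A C(1)] CA C(2) by auto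
    have "card (en e) = 2" using assms(4) e(1) by blast
    then obtain z where z: "en e = {x, z}" using x(1) by (rule other_end)
    then have "y = z" using x y by auto
    then have eAC: "en e \<subseteq> A \<union> C" using z x C by auto
    \<comment> \<open>The two parts joined by \<open>e\<close> are merged: this loses one part, and
      at least the crossing edge \<open>e\<close>.\<close>
    define P' where "P' = insert (A \<union> C) (P - {A, C})"
    have "A \<union> C \<notin> P"
    proof
      assume "A \<union> C \<in> P"
      moreover have "A \<union> C \<noteq> A" using AC by blast
      ultimately show False using dis[of "A \<union> C" A] A \<open>A \<noteq> {}\<close> by blast
    qed
    moreover have "card {A, C} = 2" using CA by auto
    moreover have "{A, C} \<subseteq> P" using A C(1) by auto
    ultimately have cP': "card P = card P' + 1" using finP card_mono[OF finP, of "{A, C}"]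
      by (simp add: P'_def card_Diff_subset)
    have "partitions P' U"
      unfolding partitions_def
    proof (intro conjI ballI impI)
      show "finite U" using less.prems by (simp add: partitions_def)
      show "\<Union>P' = U" using UP A C(1) by (auto simp: P'_def)
      show "{} \<notin> P'" using ne \<open>A \<noteq> {}\<close> by (auto simp: P'_def)
      show "X \<inter> Y = {}" if "X \<in> P'" "Y \<in> P'" "X \<noteq> Y" for X Y
      proof -
        note XY = that
        have AC_dis: "(A \<union> C) \<inter> Z = {}" if "Z \<in> P - {A, C}" for Z
          using dis[of A Z] dis[of C Z] that A C(1) by blast
        consider "X = A \<union> C" "Y \<in> P - {A, C}" | "Y = A \<union> C" "X \<in> P - {A, C}" | "X \<in> P" "Y \<in> P"
          using XY by (auto simp: P'_def)
        then show ?thesis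
          using AC_dis[of X] AC_dis[of Y] dis[of X Y] XY(3) by cases (simp_all add: Int_commute)
      qed
    qed
    have "insert e (crossing en T P') \<subseteq> crossing en T P"
    proof -
      have "e \<in> crossing en T P"
      proof -
        have "\<not> en e \<subseteq> X" if "X \<in> P" for X
        proof
          assume "en e \<subseteq> X"
          then have "A \<inter> X \<noteq> {}" "C \<inter> X \<noteq> {}" using x y C by blast+
          then show False using dis[of A X] dis[of C X] that A C(1) CA by (cases "X = A") auto
        qed
        then show ?thesis using e(1) by (simp add: crossing_def)
      qed
      moreover have "crossing en T P' \<subseteq> crossing en T P"
      proof
        fix f assume f: "f \<in> crossing en T P'"
        then have sub: "\<And>X. X \<in> P' \<Longrightarrow> \<not> en f \<subseteq> X" by (simp add: crossing_def)
        have "\<not> en f \<subseteq> X" if "X \<in> P" for X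
          using sub[of "A \<union> C"] sub[of X] that by (cases "X \<in> {A, C}") (auto simp: P'_def)
        then show "f \<in> crossing en T P" using f by (simp add: crossing_def)
      qed
      ultimately show ?thesis by blast
    qed
    moreover have "finite (crossing en T P)" using assms(3) by (simp add: crossing_def)
    ultimately have "card (insert e (crossing en T P')) \<le> card (crossing en T P)"
      by (rule card_mono[rotated])
    moreover have "e \<notin> crossing en T P'" using eAC by (simp add: crossing_def P'_def)
    moreover have "finite (crossing en T P')" using assms(3) by (simp add: crossing_def)
    ultimately have "card (crossing en T P') + 1 \<le> card (crossing en T P)" by simp
    moreover have "card P' \<le> card (crossing en T P') + 1"
      using less.hyps[OF _ \<open>partitions P' U\<close>] cP' by simp
    ultimately show ?thesis using cP' by simp
  qed simp
qed

text \<open>With \<open>F = edges G\<close> and \<open>X\<close> a set of vertices of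
  \<open>G\<close>, this says that the subgraph induced on \<open>X\<close> is 2-tree-connected.
  Nonemptiness is explicit because the empty set is linked.\<close>

definition packed :: "('b \<Rightarrow> 'a set) \<Rightarrow> 'b set \<Rightarrow> 'a set \<Rightarrow> bool" where
  "packed en F X \<longleftrightarrow> X \<noteq> {} \<and> twofold_linked en (inside en F X) X"

lemma partitions_packed:
  assumes "finite U"
  shows "partitions (maximal_parts (packed en F) U) U"
proof (rule partitions_maximal_parts[OF assms])
  show "packed en F {v}" for v
    unfolding packed_def twofold_linked_def linked_def
    by (intro conjI exI[of _ "{}"]) auto
  show "\<not> packed en F {}" by (simp add: packed_def)
  show "packed en F (X \<union> Y)" if "packed en F X" "packed en F Y" "X \<inter> Y \<noteq> {}" for X Y
    using that twofold_linked_Un[of en F X Y] by (auto simp: packed_def)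
qed

lemma packed_if_tight:
  assumes "sparse en B" "B \<subseteq> F" "tight en B Z"
  shows "packed en F Z"
proof -
  have "inside en B Z \<subseteq> inside en F Z" using assms(2) by (auto simp: inside_def)
  then have "twofold_linked en (inside en F Z) Z"
    using sparse_tight_two_trees[OF assms(1,3)] unfolding twofold_linked_def by (meson order_trans)
  then show ?thesis using assms(3) by (simp add: packed_def tight_def)
qed

text \<open>The two edge sets linking \<open>X\<close> each have an edge across every part but one of the partition
  of \<open>X\<close> into maximal tight sets, and all such edges lie in \<open>B\<close>.\<close>

lemma card_inside_packed_ge:
  assumes B: "sparse en B" and F: "finite F" "\<forall>e\<in>F. card (en e) = 2"
    and X: "finite X" "packed en F X"
    and span: "\<And>e. e \<in> F - B \<Longrightarrow> en e \<subseteq> X \<Longrightarrow> \<exists>Z\<subseteq>X. tight en B Z \<and> en e \<subseteq> Z"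
  shows "2 * card X \<le> card (inside en B X) + 2"
proof -
  let ?Q = "maximal_parts (tight en B) X" and ?BX = "inside en B X"
  obtain T1 T2 where T: "T1 \<subseteq> inside en F X" "T2 \<subseteq> inside en F X" "T1 \<inter> T2 = {}"
      "linked en T1 X" "linked en T2 X"
    using X(2) unfolding packed_def twofold_linked_def by blast
  have finT: "finite T1" "finite T2"
    using T(1,2) finite_inside[OF F(1)] finite_subset by metis+
  have endsT: "\<forall>e\<in>T1. card (en e) = 2" "\<forall>e\<in>T2. card (en e) = 2"
    using T(1,2) F(2) by (auto simp: inside_def)
  have Q: "partitions ?Q X"
  proof (rule partitions_maximal_parts[OF X(1)])
    show "tight en B {v}" for v
      by (rule tight_singleton) (simp add: sparse_card_ends[OF B])
    show "\<not> tight en B {}" by (simp add: tight_def)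
    show "tight en B (Y \<union> Z)" if "tight en B Y" "tight en B Z" "Y \<inter> Z \<noteq> {}" for Y Z
      by (rule tight_Un_Int(1)[OF B that])
  qed
  have cross: "crossing en T ?Q \<subseteq> crossing en ?BX ?Q" if T: "T \<subseteq> inside en F X" for T
  proof
    fix e assume e: "e \<in> crossing en T ?Q"
    have "e \<in> F" "en e \<subseteq> X" using e T by (auto simp: crossing_def inside_def)
    moreover have "e \<in> B"
    proof (rule ccontr)
      assume "e \<notin> B"
      then obtain Z where "Z \<subseteq> X" "tight en B Z" "en e \<subseteq> Z" using span[of e] calculation by blast
      then obtain Y where "Y \<in> ?Q" "en e \<subseteq> Y"
        using maximal_parts_above[where \<Phi> = "tight en B", OF X(1)] by (meson order_trans)
      then show False using e by (simp add: crossing_def)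
    qed
    ultimately show "e \<in> crossing en ?BX ?Q" using e by (auto simp: crossing_def inside_def)
  qed
  have finBX: "finite ?BX" using sparse_finite[OF B] by (rule finite_inside)
  have disT: "crossing en T1 ?Q \<inter> crossing en T2 ?Q = {}" using T(3) by (auto simp: crossing_def)
  have "2 * card ?Q \<le> card (crossing en T1 ?Q) + card (crossing en T2 ?Q) + 2"
    using card_crossing_linked[OF T(4) Q finT(1) endsT(1)]
      card_crossing_linked[OF T(5) Q finT(2) endsT(2)] by linarith
  also have "card (crossing en T1 ?Q) + card (crossing en T2 ?Q) =
      card (crossing en T1 ?Q \<union> crossing en T2 ?Q)"
    using finT disT by (intro card_Un_disjoint[symmetric]) (auto simp: crossing_def)
  also have "\<dots> \<le> card (crossing en ?BX ?Q)"
    using cross[OF T(1)] cross[OF T(2)] finBX by (intro card_mono) (auto simp: crossing_def)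
  finally have 1: "2 * card ?Q \<le> card (crossing en ?BX ?Q) + 2" by simp
  have "(\<Sum>Y\<in>?Q. card (inside en ?BX Y) + 2) = (\<Sum>Y\<in>?Q. 2 * card Y)"
  proof (rule sum.cong[OF refl])
    fix Y assume "Y \<in> ?Q"
    then have "Y \<subseteq> X" "tight en B Y" by (auto simp: maximal_parts_def)
    moreover from this have "inside en ?BX Y = inside en B Y" by (auto simp: inside_def)
    ultimately show "card (inside en ?BX Y) + 2 = 2 * card Y" by (simp add: tight_def)
  qed
  \<comment> \<open>The tight parts span exactly \<open>2 * card X - 2 * card ?Q\<close> edges of
    \<open>B\<close> in total. The crossing edges counted in \<open>1\<close> supply the missing
    \<open>2 * card ?Q - 2\<close>.\<close>
  then have 2: "(\<Sum>Y\<in>?Q. card (inside en ?BX Y)) + 2 * card ?Q = 2 * card X"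
    unfolding sum.distrib sum_distrib_left[symmetric] sum_card_partitions[OF Q] by simp
  have ne: "\<forall>e\<in>?BX. en e \<noteq> {}" using sparse_card_ends[OF B] by (force simp: inside_def)
  show ?thesis
    using 1 2 card_crossing[OF Q finBX ne] by linarith
qed

section \<open>Omega of induced subgraphs in terms of sparse sets\<close>

lemma multigraph_induced: "multigraph G \<Longrightarrow> multigraph (induced G U)"
  by (auto simp: multigraph_def induced_def)

lemma tree_components_induced:
  assumes G: "multigraph G" and U: "U \<subseteq> verts G"
  shows "tree_components 2 (induced G U) = maximal_parts (packed (ends G) (edges G)) U"
proof -
  have "tree_connected 2 (induced (induced G U) X) \<longleftrightarrow> packed (ends G) (edges G) X" if "X \<subseteq> U" for X
  proof -
    have "verts G \<inter> U \<inter> X = verts G \<inter> X"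
        "{e \<in> edges G. ends G e \<subseteq> U \<and> ends G e \<subseteq> X} = {e \<in> edges G. ends G e \<subseteq> X}"
      using that by auto
    then have "induced (induced G U) X = induced G X" by (simp add: induced_def)
    moreover have "verts (induced G X) = X" using that U by (auto simp: induced_def)
    moreover have "edges (induced G X) = inside (ends G) (edges G) X" "ends (induced G X) = ends G"
      by (simp_all add: induced_def inside_def)
    ultimately show ?thesis
      using tree_connected_2_iff[OF multigraph_induced[OF G, of X]] by (simp add: packed_def)
  qed
  moreover have "verts (induced G U) = U" using U by (auto simp: induced_def)
  ultimately show ?thesis
    unfolding tree_components_def maximal_parts_def by (intro Collect_cong) auto
qed

text \<open>For an edge with two ends in \<open>U\<close>, meeting two different parts is the same
  as lying in no part, since the parts are disjoint and cover \<open>U\<close>.\<close>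

lemma Omega_induced:
  fixes G :: "('a, 'b) mgraph"
  assumes G: "multigraph G" and U: "U \<subseteq> verts G"
  defines "P \<equiv> maximal_parts (packed (ends G) (edges G)) U"
  shows "Omega 2 (induced G U) =
    2 * int (card P) - int (card (crossing (ends G) (inside (ends G) (edges G) U) P))"
proof -
  have "finite U" using G U by (auto simp: multigraph_def intro: finite_subset)
  then have "partitions P U" unfolding P_def by (rule partitions_packed)
  then have UP: "\<Union>P = U" and dis: "\<And>X Y. X \<in> P \<Longrightarrow> Y \<in> P \<Longrightarrow> X \<noteq> Y \<Longrightarrow> X \<inter> Y = {}"
    by (auto simp: partitions_def)
  define split where "split = (\<lambda>e. \<exists>X\<in>P. \<exists>Y\<in>P. X \<noteq> Y \<and> ends G e \<inter> X \<noteq> {} \<and> ends G e \<inter> Y \<noteq> {})"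
  have split: "split e \<longleftrightarrow> (\<forall>X\<in>P. \<not> ends G e \<subseteq> X)" (is "?L \<longleftrightarrow> ?R") if e: "e \<in> edges G" "ends G e \<subseteq> U" for e
  proof
    assume ?L
    then obtain X Y where XY: "X \<in> P" "Y \<in> P" "X \<noteq> Y" "ends G e \<inter> X \<noteq> {}" "ends G e \<inter> Y \<noteq> {}"
      unfolding split_def by blast
    show ?R
    proof (intro ballI notI)
      fix Z assume Z: "Z \<in> P" "ends G e \<subseteq> Z"
      then have "Z \<inter> X \<noteq> {}" "Z \<inter> Y \<noteq> {}" using XY by blast+
      then show False using dis[OF Z(1) XY(1)] dis[OF Z(1) XY(2)] XY(3) by metis
    qed
  next
    assume R: ?R
    have "card (ends G e) = 2" using G e(1) by (simp add: multigraph_def)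
    then obtain x y where xy: "ends G e = {x, y}" by (meson card_2_iff)
    then obtain X Y where XY: "X \<in> P" "Y \<in> P" "x \<in> X" "y \<in> Y" using e(2) UP by auto
    moreover have "X \<noteq> Y" using R XY xy by auto
    ultimately show ?L using xy unfolding split_def by blast
  qed
  have "{e \<in> edges (induced G U). split e} = crossing (ends G) (inside (ends G) (edges G) U) P"
    using split by (auto simp: induced_def crossing_def inside_def)
  then have "crossing_edges (induced G U) P = card (crossing (ends G) (inside (ends G) (edges G) U) P)"
    by (simp add: crossing_edges_def split_def induced_def)
  then show ?thesis
    using tree_components_induced[OF G U] by (simp add: Omega_def P_def)
qed

text \<open>Each component \<open>Y\<close> spans at most \<open>2 * card Y - 2\<close> edges of
  \<open>B\<close>, and the edges of \<open>B\<close> between components are among those of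
  \<open>G\<close>. Summing over the components gives the bound.\<close>

lemma Omega_induced_le:
  assumes G: "multigraph G" and U: "U \<subseteq> verts G" and B: "sparse (ends G) B" "B \<subseteq> edges G"
  shows "Omega 2 (induced G U) \<le> 2 * int (card U) - int (card (inside (ends G) B U))"
proof -
  let ?en = "ends G"
  let ?P = "maximal_parts (packed ?en (edges G)) U" and ?BU = "inside ?en B U"
  have finU: "finite U" using G U by (auto simp: multigraph_def intro: finite_subset)
  have P: "partitions ?P U" using finU by (rule partitions_packed)
  have finBU: "finite ?BU" using sparse_finite[OF B(1)] by (rule finite_inside)
  have finE: "finite (edges G)" using G by (simp add: multigraph_def)
  have "(\<Sum>Y\<in>?P. card (inside ?en ?BU Y) + 2) \<le> (\<Sum>Y\<in>?P. 2 * card Y)"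
  proof (rule sum_mono)
    fix Y assume Y: "Y \<in> ?P"
    then have "Y \<subseteq> U" "Y \<noteq> {}" by (auto simp: maximal_parts_def packed_def)
    moreover from this have "inside ?en ?BU Y = inside ?en B Y" by (auto simp: inside_def)
    ultimately show "card (inside ?en ?BU Y) + 2 \<le> 2 * card Y"
      using sparse_card_inside[OF B(1)] finite_subset[OF _ finU] by metis
  qed
  then have 2: "(\<Sum>Y\<in>?P. card (inside ?en ?BU Y)) + 2 * card ?P \<le> 2 * card U"
    unfolding sum.distrib sum_distrib_left[symmetric] sum_card_partitions[OF P] by simp
  have ne: "\<forall>e\<in>?BU. ?en e \<noteq> {}" using sparse_card_ends[OF B(1)] by (force simp: inside_def)
  have "card (crossing ?en ?BU ?P) \<le> card (crossing ?en (inside ?en (edges G) U) ?P)"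
    using finE B(2) by (intro card_mono) (auto simp: crossing_def inside_def)
  then show ?thesis
    using 2 card_crossing[OF P finBU ne] Omega_induced[OF G U] by linarith
qed

text \<open>The converse estimate when every edge of \<open>G\<close> in \<open>U\<close> outside
  \<open>B\<close> is spanned by a tight subset of \<open>U\<close>. Then each component is tight,
  and every edge between components belongs to \<open>B\<close>.\<close>

lemma Omega_induced_ge:
  assumes G: "multigraph G" and U: "U \<subseteq> verts G" and B: "sparse (ends G) B" "B \<subseteq> edges G"
    and span: "\<And>e. e \<in> edges G - B \<Longrightarrow> ends G e \<subseteq> U \<Longrightarrow> \<exists>Z\<subseteq>U. tight (ends G) B Z \<and> ends G e \<subseteq> Z"
  shows "2 * int (card U) - int (card (inside (ends G) B U)) \<le> Omega 2 (induced G U)"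
proof -
  let ?en = "ends G"
  let ?P = "maximal_parts (packed ?en (edges G)) U" and ?BU = "inside ?en B U"
  have finU: "finite U" using G U by (auto simp: multigraph_def intro: finite_subset)
  have P: "partitions ?P U" using finU by (rule partitions_packed)
  have finBU: "finite ?BU" using sparse_finite[OF B(1)] by (rule finite_inside)
  have finE: "finite (edges G)" and endsE: "\<forall>e\<in>edges G. card (?en e) = 2"
    using G by (simp_all add: multigraph_def)
  have above: "\<exists>X\<in>?P. Z \<subseteq> X" if "Z \<subseteq> U" "tight ?en B Z" for Z
    using maximal_parts_above[OF finU that(1)] packed_if_tight[OF B that(2)] .
  have "(\<Sum>Y\<in>?P. 2 * card Y) \<le> (\<Sum>Y\<in>?P. card (inside ?en ?BU Y) + 2)"
  proof (rule sum_mono)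
    fix Y assume Y: "Y \<in> ?P"
    then have "Y \<subseteq> U" and pY: "packed ?en (edges G) Y" by (auto simp: maximal_parts_def)
    then have finY: "finite Y" using finU finite_subset by blast
    have "\<exists>Z\<subseteq>Y. tight ?en B Z \<and> ?en e \<subseteq> Z" if e: "e \<in> edges G - B" "?en e \<subseteq> Y" for e
    proof -
      obtain Z where Z: "Z \<subseteq> U" "tight ?en B Z" "?en e \<subseteq> Z" using span[of e] e \<open>Y \<subseteq> U\<close> by blast
      \<comment> \<open>The tight set spanning \<open>e\<close> lies in some component, which meets
        \<open>Y\<close> in the ends of \<open>e\<close> and therefore equals
        \<open>Y\<close>.\<close>
      obtain X where X: "X \<in> ?P" "Z \<subseteq> X" using above[OF Z(1,2)] by blast
      have "?en e \<noteq> {}" using endsE e(1) by force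
      then have "X \<inter> Y \<noteq> {}" using X(2) Z(3) e(2) by blast
      then have "X = Y" using P X(1) Y unfolding partitions_def by metis
      then show ?thesis using X Z by blast
    qed
    then have "2 * card Y \<le> card (inside ?en B Y) + 2"
      by (rule card_inside_packed_ge[OF B(1) finE endsE finY pY])
    moreover have "inside ?en ?BU Y = inside ?en B Y" using \<open>Y \<subseteq> U\<close> by (auto simp: inside_def)
    ultimately show "2 * card Y \<le> card (inside ?en ?BU Y) + 2" by simp
  qed
  then have 2: "2 * card U \<le> (\<Sum>Y\<in>?P. card (inside ?en ?BU Y)) + 2 * card ?P"
    unfolding sum.distrib sum_distrib_left[symmetric] sum_card_partitions[OF P] by simp
  have ne: "\<forall>e\<in>?BU. ?en e \<noteq> {}" using sparse_card_ends[OF B(1)] by (force simp: inside_def)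
  have "crossing ?en (inside ?en (edges G) U) ?P \<subseteq> crossing ?en ?BU ?P"
  proof
    fix e assume e: "e \<in> crossing ?en (inside ?en (edges G) U) ?P"
    then have eE: "e \<in> edges G" "?en e \<subseteq> U" by (auto simp: crossing_def inside_def)
    have "e \<in> B"
    proof (rule ccontr)
      assume "e \<notin> B"
      then obtain Z where Z: "Z \<subseteq> U" "tight ?en B Z" "?en e \<subseteq> Z" using span[of e] eE by blast
      then obtain X where "X \<in> ?P" "?en e \<subseteq> X" using above[OF Z(1,2)] by blast
      then show False using e by (simp add: crossing_def)
    qed
    then show "e \<in> crossing ?en ?BU ?P" using e by (auto simp: crossing_def inside_def)
  qed
  then have "card (crossing ?en (inside ?en (edges G) U) ?P) \<le> card (crossing ?en ?BU ?P)"
    using finBU by (intro card_mono) (auto simp: crossing_def)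
  then show ?thesis
    using 2 card_crossing[OF P finBU ne] Omega_induced[OF G U] by linarith
qed

subsection \<open>Exchanges\<close>

lemma card_inside_insert_ends:
  assumes "finite F" "e \<notin> F" "en e \<subseteq> X"
  shows "card (inside en (insert e F) X) = Suc (card (inside en F X))"
proof -
  have "inside en (insert e F) X = insert e (inside en F X)" using assms by (auto simp: inside_def)
  then show ?thesis using assms finite_inside[OF assms(1)] by (simp add: inside_def)
qed

lemma inside_insert_not_ends:
  "\<not> en e \<subseteq> X \<Longrightarrow> inside en (insert e F) X = inside en F X"
  by (auto simp: inside_def)

text \<open>A set whose bound fails after adding one edge must contain the ends of that edge and
  have met its bound with equality before.\<close>

lemma tight_if_not_sparse_insert:
  assumes B: "sparse en B" and e: "e \<notin> B" "card (en e) = 2" and ns: "\<not> sparse en (insert e B)"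
  shows "\<exists>X. tight en B X \<and> en e \<subseteq> X"
proof -
  have fin: "finite B" using B by (rule sparse_finite)
  obtain X where X: "finite X" "X \<noteq> {}" "\<not> card (inside en (insert e B) X) + 2 \<le> 2 * card X"
    using ns B e unfolding sparse_def by auto
  have le: "card (inside en B X) + 2 \<le> 2 * card X" using sparse_card_inside[OF B X(1,2)] .
  have eX: "en e \<subseteq> X"
  proof (rule ccontr)
    assume "\<not> en e \<subseteq> X"
    then show False using X(3) le by (simp add: inside_insert_not_ends)
  qed
  have "card (inside en B X) + 2 = 2 * card X"
    using X(3) le unfolding card_inside_insert_ends[where en = en, OF fin e(1) eX] by linarith
  then show ?thesis using X eX by (auto simp: tight_def)
qed

text \<open>Points outside \<open>V\<close> span no edges of \<open>B\<close>, so discarding them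
  cannot lose edges. This is needed because tight sets range over the whole type.\<close>

lemma tight_Int_verts:
  assumes "sparse en B" "\<forall>e\<in>B. en e \<subseteq> V" "tight en B X" "X \<inter> V \<noteq> {}"
  shows "tight en B (X \<inter> V)"
proof -
  have X: "finite X" "card (inside en B X) + 2 = 2 * card X" using assms(3) by (auto simp: tight_def)
  have "inside en B (X \<inter> V) = inside en B X" using assms(2) by (auto simp: inside_def)
  moreover have "card (X \<inter> V) \<le> card X" using X(1) by (simp add: card_mono)
  ultimately have "card (inside en B (X \<inter> V)) + 2 = 2 * card (X \<inter> V)"
    using X sparse_card_inside[OF assms(1), of "X \<inter> V"] assms(4) by simp
  then show ?thesis using X(1) assms(4) by (simp add: tight_def)
qed

lemma sparse_empty: "sparse (en :: 'b \<Rightarrow> 'a set) {}"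
proof -
  have "0 < card X" if "finite X" "X \<noteq> {}" for X :: "'a set"
    using that by (simp add: card_gt_0_iff)
  then show ?thesis by (fastforce simp: sparse_def inside_def)
qed

text \<open>For a maximal sparse set, every other edge of \<open>G\<close> lies in a tight set, so
  the lower bound on \<open>Omega\<close> applies to the whole vertex set and gives at least
  \<open>2 * card (verts G) - 2\<close> edges.\<close>

lemma exists_sparse_spanning:
  fixes G :: "('a, 'b) mgraph"
  assumes G: "multigraph G" and V: "verts G \<noteq> {}" and Om: "Omega 2 (induced G (verts G)) \<le> 2"
  shows "\<exists>B\<subseteq>edges G. sparse (ends G) B \<and> tight (ends G) B (verts G)"
proof -
  let ?en = "ends G"
  have finV: "finite (verts G)" and finE: "finite (edges G)"
    and endsE: "\<And>e. e \<in> edges G \<Longrightarrow> ?en e \<subseteq> verts G \<and> card (?en e) = 2"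
    using G by (auto simp: multigraph_def)
  have "finite {B. B \<subseteq> edges G \<and> sparse ?en B}" using finE by simp
  then obtain B where "B \<in> {B. B \<subseteq> edges G \<and> sparse ?en B}"
      and max: "\<forall>B'\<in>{B. B \<subseteq> edges G \<and> sparse ?en B}. B \<subseteq> B' \<longrightarrow> B = B'"
    using finite_has_maximal2[of "{B. B \<subseteq> edges G \<and> sparse ?en B}" "{}"] sparse_empty by blast
  then have B: "B \<subseteq> edges G" "sparse ?en B" by simp_all
  have BV: "\<forall>e\<in>B. ?en e \<subseteq> verts G" using B(1) endsE by blast
  have "\<exists>Z\<subseteq>verts G. tight ?en B Z \<and> ?en e \<subseteq> Z" if e: "e \<in> edges G - B" for e
  proof -
    have "\<not> sparse ?en (insert e B)" using max e B(1) by blast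
    then obtain X where X: "tight ?en B X" "?en e \<subseteq> X"
      using tight_if_not_sparse_insert[OF B(2), of e] e endsE by blast
    have "?en e \<subseteq> X \<inter> verts G" "?en e \<noteq> {}" using X endsE[of e] e by auto
    then show ?thesis using tight_Int_verts[OF B(2) BV X(1)] by blast
  qed
  then have "2 * int (card (verts G)) - int (card (inside ?en B (verts G))) \<le> 2"
    using Omega_induced_ge[OF G subset_refl B(2,1)] Om by fastforce
  then have "tight ?en B (verts G)"
    using sparse_card_inside[OF B(2) finV V] finV V by (simp add: tight_def)
  then show ?thesis using B by blast
qed

section \<open>Replacing the edges inside a tight set\<close>

definition replace_inside :: "('b \<Rightarrow> 'a set) \<Rightarrow> 'b set \<Rightarrow> 'a set \<Rightarrow> 'b set \<Rightarrow> 'b set" where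
  "replace_inside en B X F = (B - inside en B X) \<union> F"

lemma card_inside_replace:
  assumes B: "sparse en B" "tight en B Y"
    and F: "finite F" "\<forall>e\<in>F. en e \<subseteq> Y" "card F + 2 = 2 * card Y" and K: "Y \<subseteq> K"
  shows "card (inside en (replace_inside en B Y F) K) = card (inside en B K)"
proof -
  have fin: "finite (inside en B K)" using sparse_finite[OF B(1)] by (rule finite_inside)
  have sub: "inside en B Y \<subseteq> inside en B K" using K by (auto simp: inside_def)
  have "inside en (replace_inside en B Y F) K = (inside en B K - inside en B Y) \<union> F"
    using F(2) K by (auto simp: inside_def replace_inside_def)
  moreover have "card ((inside en B K - inside en B Y) \<union> F) = card (inside en B K - inside en B Y) + card F"
    using fin F(1,2) by (intro card_Un_disjoint) (auto simp: inside_def)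
  moreover have "card (inside en B K - inside en B Y) + card (inside en B Y) = card (inside en B K)"
    using fin sub by (metis card_Diff_subset card_mono finite_subset le_add_diff_inverse2)
  ultimately show ?thesis using B(2) F(3) by (simp add: tight_def)
qed

text \<open>By supermodularity, \<open>W\<close> is compared with \<open>W \<union> Y\<close> and
  \<open>W \<inter> Y\<close>. The union keeps its number of edges, the intersection is bounded by
  sparsity of \<open>F\<close>, and \<open>Y\<close> itself spans exactly \<open>card F\<close>
  edges.\<close>

lemma sparse_replace:
  assumes B: "sparse en B" "tight en B Y"
    and F: "sparse en F" "\<forall>e\<in>F. en e \<subseteq> Y" "card F + 2 = 2 * card Y"
  shows "sparse en (replace_inside en B Y F)"
proof -
  let ?B = "replace_inside en B Y F"
  have finF: "finite F" using F(1) by (rule sparse_finite)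
  have finB: "finite ?B" using sparse_finite[OF B(1)] finF by (simp add: replace_inside_def)
  have Y: "finite Y" "Y \<noteq> {}" using B(2) by (auto simp: tight_def)
  have two: "\<forall>e\<in>?B. card (en e) = 2"
    using sparse_card_ends[OF B(1)] sparse_card_ends[OF F(1)] by (auto simp: replace_inside_def)
  have "card (inside en ?B W) + 2 \<le> 2 * card W" if W: "finite W" "W \<noteq> {}" for W
  proof (cases "W \<inter> Y = {}")
    case True
    have "en e \<noteq> {}" if "e \<in> F" for e using sparse_card_ends[OF F(1) that] by auto
    then have "inside en ?B W \<subseteq> inside en B W"
      using True F(2) by (force simp: inside_def replace_inside_def)
    then have "card (inside en ?B W) \<le> card (inside en B W)"
      by (intro card_mono finite_inside sparse_finite[OF B(1)])
    then show ?thesis using sparse_card_inside[OF B(1) W] by simp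
  next
    case False
    have "inside en ?B (W \<inter> Y) = inside en F (W \<inter> Y)" "inside en ?B Y = F"
      using F(2) by (auto simp: inside_def replace_inside_def)
    moreover have "card (inside en F (W \<inter> Y)) + 2 \<le> 2 * card (W \<inter> Y)"
      using sparse_card_inside[OF F(1), of "W \<inter> Y"] W False by simp
    moreover have "card (inside en ?B (W \<union> Y)) + 2 \<le> 2 * card (W \<union> Y)"
      using card_inside_replace[OF B finF F(2,3), of "W \<union> Y"]
        sparse_card_inside[OF B(1), of "W \<union> Y"] W Y by simp
    moreover have "card W + card Y = card (W \<union> Y) + card (W \<inter> Y)"
      using W(1) Y(1) by (rule card_Un_Int)
    ultimately show ?thesis
      using inside_supermodular[OF finB, of en W Y] F(3) by simp
  qed
  then show ?thesis using finB two by (auto simp: sparse_def)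
qed

lemma deg_replace_outside:
  assumes "\<forall>e\<in>F. en e \<subseteq> Y" "v \<notin> Y"
  shows "deg en (replace_inside en B Y F) v = deg en B v"
  unfolding deg_def replace_inside_def using assms
  by (intro arg_cong[of _ _ card]) (auto simp: inside_def)

text \<open>If adding \<open>e\<close> after deleting \<open>e'\<close> fails, some set containing
  the ends of \<open>e\<close> is tight after the deletion. If it contains the ends of
  \<open>e'\<close> as well, restoring \<open>e'\<close> exceeds the bound; otherwise it was tight
  for \<open>B\<close>, contrary to \<open>W\<close>.\<close>

lemma sparse_exchange:
  assumes B: "sparse en B" and e: "e \<notin> B" "card (en e) = 2" and e': "e' \<in> B"
    and W: "\<And>W. tight en B W \<Longrightarrow> en e \<subseteq> W \<Longrightarrow> en e' \<subseteq> W"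
  shows "sparse en (insert e (B - {e'}))"
proof (rule ccontr)
  have sp: "sparse en (B - {e'})" using B by (rule sparse_subset) blast
  assume "\<not> ?thesis"
  then obtain X where X: "tight en (B - {e'}) X" "en e \<subseteq> X"
    using tight_if_not_sparse_insert[OF sp, of e] e by blast
  have fX: "finite X" "X \<noteq> {}" using X by (auto simp: tight_def)
  have ins: "insert e' (B - {e'}) = B" using e' by blast
  have fin: "finite (B - {e'})" using sparse_finite[OF B] by simp
  show False
  proof (cases "en e' \<subseteq> X")
    case True
    then have "card (inside en B X) = Suc (card (inside en (B - {e'}) X))"
      using card_inside_insert_ends[OF fin, of e' en X] ins by simp
    then show False using sparse_card_inside[OF B fX] X(1) by (simp add: tight_def)
  next
    case False
    then have "tight en B X"
      using X(1) inside_insert_not_ends[of en e' X "B - {e'}"] ins by (simp add: tight_def)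
    then show False using W X(2) False by blast
  qed
qed

text \<open>Tight sets containing the nonempty set \<open>A\<close> are closed under intersection,
  so one of least size is contained in all of them.\<close>

lemma exists_least_tight:
  assumes "sparse en B" "tight en B V" "A \<subseteq> V" "A \<noteq> {}"
  shows "\<exists>Z. tight en B Z \<and> A \<subseteq> Z \<and> (\<forall>W. tight en B W \<longrightarrow> A \<subseteq> W \<longrightarrow> Z \<subseteq> W)"
proof -
  obtain Z where Z: "tight en B Z" "A \<subseteq> Z"
    and min: "\<And>W. tight en B W \<Longrightarrow> A \<subseteq> W \<Longrightarrow> card Z \<le> card W"
    using ex_has_least_nat[of "\<lambda>Z. tight en B Z \<and> A \<subseteq> Z" V card] assms by blast
  have "Z \<subseteq> W" if W: "tight en B W" "A \<subseteq> W" for W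
  proof -
    have "tight en B (Z \<inter> W)" using tight_Un_Int(2)[OF assms(1) Z(1) W(1)] Z W assms(4) by blast
    then have "card Z \<le> card (Z \<inter> W)" using min Z W by simp
    moreover have "finite Z" using Z(1) by (simp add: tight_def)
    ultimately have "Z \<inter> W = Z" by (intro card_seteq) auto
    then show ?thesis by blast
  qed
  then show ?thesis using Z by blast
qed

text \<open>Otherwise \<open>Z - {w}\<close>, nonempty because of \<open>u\<close>, would span all
  the edges of \<open>Z\<close> with one vertex fewer.\<close>

lemma tight_edge_at:
  assumes B: "sparse en B" and Z: "tight en B Z" "w \<in> Z" "u \<in> Z" "u \<noteq> w"
  shows "\<exists>e\<in>B. en e \<subseteq> Z \<and> w \<in> en e"
proof (rule ccontr)
  assume "\<not> ?thesis"
  then have "inside en B Z = inside en B (Z - {w})" by (auto simp: inside_def)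
  moreover have "finite Z" "card (inside en B Z) + 2 = 2 * card Z" using Z(1) by (auto simp: tight_def)
  moreover from this have "card (inside en B (Z - {w})) + 2 \<le> 2 * card (Z - {w})"
    using sparse_card_inside[OF B, of "Z - {w}"] Z by auto
  moreover have "card (Z - {w}) < card Z" using Z(2) \<open>finite Z\<close> by (intro psubset_card_mono) auto
  ultimately show False by simp
qed

lemma deg_mono: "finite F \<Longrightarrow> F' \<subseteq> F \<Longrightarrow> deg en F' v \<le> deg en F v"
  unfolding deg_def by (intro card_mono) auto

lemma deg_insert_le: "finite F \<Longrightarrow> deg en (insert e F) v \<le> deg en F v + (if v \<in> en e then 1 else 0)"
proof -
  assume "finite F"
  have "{e' \<in> insert e F. v \<in> en e'} = (if v \<in> en e then insert e {e' \<in> F. v \<in> en e'} else {e' \<in> F. v \<in> en e'})"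
    by auto
  then show ?thesis using \<open>finite F\<close> by (simp add: deg_def card_insert_if)
qed

lemma deg_remove: "finite F \<Longrightarrow> e \<in> F \<Longrightarrow> v \<in> en e \<Longrightarrow> deg en (F - {e}) v < deg en F v"
  unfolding deg_def by (intro psubset_card_mono) auto

text \<open>\<open>F\<close> is a substitute for \<open>B\<close> inside the tight set \<open>X\<close> that creates no overload in \<open>X\<close> and leaves
  \<open>w\<close> unsaturated.\<close>

definition frees :: "('b \<Rightarrow> 'a set) \<Rightarrow> ('a \<Rightarrow> nat) \<Rightarrow> 'b set \<Rightarrow> 'b set \<Rightarrow> 'a \<Rightarrow> 'a set \<Rightarrow> 'b set \<Rightarrow> bool" where
  "frees en g E B w X F \<longleftrightarrow> tight en B X \<and> w \<in> X \<and> sparse en F \<and> F \<subseteq> E \<and> (\<forall>e\<in>F. en e \<subseteq> X) \<and>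
     card F + 2 = 2 * card X \<and> (\<forall>v\<in>X. deg en (replace_inside en B X F) v \<le> g v) \<and>
     deg en (replace_inside en B X F) w < g w"

text \<open>Since \<open>X\<close> and \<open>Y\<close> are disjoint, both substitutes can be
  inserted at once, making room for one more edge at \<open>x\<close> and at \<open>y\<close>. Then
  \<open>e\<close> enters and an edge at \<open>w\<close> leaves. All changes are confined to
  \<open>K\<close>, and are packed into a single substitute for \<open>B\<close> inside
  \<open>K\<close>.\<close>

lemma exchange_after_freeing:
  assumes B: "sparse en B" "B \<subseteq> E"
    and e: "e \<in> E - B" "en e = {x, y}"
    and FX: "frees en g E B x X FX" and FY: "frees en g E B y Y FY" and XY: "X \<inter> Y = {}"
    and Z: "tight en B Z" "{x, y} \<subseteq> Z" "\<And>W. tight en B W \<Longrightarrow> {x, y} \<subseteq> W \<Longrightarrow> Z \<subseteq> W"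
    and w: "w \<in> Z" "w \<notin> X \<union> Y"
  defines "K \<equiv> Z \<union> X \<union> Y"
  shows "tight en B K"
    and "\<exists>F. sparse en F \<and> F \<subseteq> E \<and> (\<forall>e\<in>F. en e \<subseteq> K) \<and> card F + 2 = 2 * card K \<and>
      (\<forall>v\<in>X \<union> Y. deg en (replace_inside en B K F) v \<le> g v) \<and>
      (\<forall>v. v \<notin> X \<union> Y \<longrightarrow> deg en (replace_inside en B K F) v \<le> deg en B v) \<and>
      deg en (replace_inside en B K F) w < deg en B w"
proof -
  have X: "tight en B X" "x \<in> X" "sparse en FX" "FX \<subseteq> E" "\<forall>e\<in>FX. en e \<subseteq> X" "card FX + 2 = 2 * card X"
      "\<And>v. v \<in> X \<Longrightarrow> deg en (replace_inside en B X FX) v \<le> g v"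
      "deg en (replace_inside en B X FX) x < g x"
    using FX by (auto simp: frees_def)
  have Y: "tight en B Y" "y \<in> Y" "sparse en FY" "FY \<subseteq> E" "\<forall>e\<in>FY. en e \<subseteq> Y" "card FY + 2 = 2 * card Y"
      "\<And>v. v \<in> Y \<Longrightarrow> deg en (replace_inside en B Y FY) v \<le> g v"
      "deg en (replace_inside en B Y FY) y < g y"
    using FY by (auto simp: frees_def)
  have ZX: "tight en B (Z \<union> X)" using tight_Un_Int(1)[OF B(1) Z(1) X(1)] Z(2) X(2) by blast
  show K: "tight en B K"
    unfolding K_def using tight_Un_Int(1)[OF B(1) ZX Y(1)] Z(2) Y(2) by blast
  have finFX: "finite FX" "finite FY" using X(3) Y(3) by (auto dest: sparse_finite)
  have neFX: "\<forall>e\<in>FX. en e \<noteq> {}" using sparse_card_ends[OF X(3)] by force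
  have neFY: "\<forall>e\<in>FY. en e \<noteq> {}" using sparse_card_ends[OF Y(3)] by force
  have neB: "\<forall>e\<in>B. en e \<noteq> {}" using sparse_card_ends[OF B(1)] by force
  define B1 where "B1 = replace_inside en B X FX"
  define B2 where "B2 = replace_inside en B1 Y FY"
  have sp1: "sparse en B1" unfolding B1_def using sparse_replace B(1) X by blast
  have "inside en B1 Y = inside en B Y"
  proof -
    have "\<not> en e' \<subseteq> Y" if "e' \<in> FX" for e' using that X(5) neFX XY by blast
    moreover have "\<not> en e' \<subseteq> Y" if "e' \<in> inside en B X" for e'
      using that neB XY by (auto simp: inside_def)
    ultimately show ?thesis by (auto simp: B1_def replace_inside_def inside_def)
  qed
  then have tY1: "tight en B1 Y" using Y(1) by (simp add: tight_def)
  have sp2: "sparse en B2" unfolding B2_def using sparse_replace sp1 tY1 Y by blast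
  \<comment> \<open>Sets containing both \<open>X\<close> and \<open>Y\<close> keep their number of
    edges, so such a set is tight for \<open>B2\<close> exactly if it is tight for
    \<open>B\<close>.\<close>
  have cB2: "card (inside en B2 W) = card (inside en B W)" if "X \<subseteq> W" "Y \<subseteq> W" for W
    using card_inside_replace[OF sp1 tY1 finFX(2) Y(5,6) that(2)]
      card_inside_replace[OF B(1) X(1) finFX(1) X(5,6) that(1)] by (simp add: B1_def B2_def)
  have B2E: "B2 \<subseteq> E" using B(2) X(4) Y(4) by (auto simp: B2_def B1_def replace_inside_def)
  have degX: "deg en B2 v = deg en (replace_inside en B X FX) v" if "v \<notin> Y" for v
    unfolding B2_def B1_def[symmetric] using deg_replace_outside Y(5) that by metis
  have degY: "deg en B2 v = deg en (replace_inside en B Y FY) v" if "v \<in> Y" for v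
  proof -
    have "v \<notin> X" using that XY by blast
    then have "{e \<in> B2. v \<in> en e} = {e \<in> replace_inside en B Y FY. v \<in> en e}"
      using X(5) by (auto simp: B2_def B1_def replace_inside_def inside_def)
    then show ?thesis by (simp add: deg_def)
  qed
  have degO: "deg en B2 v = deg en B v" if "v \<notin> X \<union> Y" for v
    using degX[of v] deg_replace_outside[OF X(5), of v] that by simp
  have KX: "X \<subseteq> K" "Y \<subseteq> K" "Z \<subseteq> K" by (auto simp: K_def)
  have tK2: "tight en B2 K" using K cB2[OF KX(1,2)] by (simp add: tight_def)
  have eB2: "e \<notin> B2"
  proof -
    have "e \<notin> FX"
    proof
      assume "e \<in> FX"
      then have "y \<in> X" using X(5) e(2) by auto
      then show False using Y(2) XY by blast
    qed
    moreover have "e \<notin> FY"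
    proof
      assume "e \<in> FY"
      then have "x \<in> Y" using Y(5) e(2) by auto
      then show False using X(2) XY by blast
    qed
    ultimately show ?thesis using e(1) by (simp add: B2_def B1_def replace_inside_def)
  qed
  have xyK: "{x, y} \<subseteq> K" using Z(2) KX(3) by blast
  obtain Z' where Z': "tight en B2 Z'" "{x, y} \<subseteq> Z'" "\<And>W. tight en B2 W \<Longrightarrow> {x, y} \<subseteq> W \<Longrightarrow> Z' \<subseteq> W"
    using exists_least_tight[OF sp2 tK2 xyK] by blast
  \<comment> \<open>The least tight set around \<open>x\<close> and \<open>y\<close> may change from
    \<open>Z\<close> to \<open>Z'\<close>. But \<open>Z' \<union> X \<union> Y\<close> is tight for
    \<open>B2\<close>, hence for \<open>B\<close>, so it contains \<open>Z\<close>; and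
    \<open>w\<close> lies in \<open>Z\<close> but not in \<open>X \<union> Y\<close>.\<close>
  have wZ': "w \<in> Z'"
  proof -
    have tX2: "tight en B2 X" "tight en B2 Y"
    proof -
      have "\<not> en e' \<subseteq> X" if "e' \<in> FY" for e'
        using that Y(5) neFY XY by blast
      then have "inside en B2 X = inside en B1 X - inside en B1 Y"
        by (auto simp: B2_def replace_inside_def inside_def)
      moreover have "inside en B1 X = FX"
        using X(5) by (auto simp: B1_def replace_inside_def inside_def)
      moreover have "\<not> en e' \<subseteq> Y" if "e' \<in> FX" for e' using that X(5) neFX XY by blast
      then have "FX \<inter> inside en B1 Y = {}" by (auto simp: inside_def)
      ultimately have "inside en B2 X = FX" by auto
      then show "tight en B2 X" using X(1,6) by (simp add: tight_def)
      have "inside en B2 Y = FY"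
        using Y(5) by (auto simp: B2_def replace_inside_def inside_def)
      then show "tight en B2 Y" using Y(1,6) by (simp add: tight_def)
    qed
    have "tight en B2 (Z' \<union> X)" using tight_Un_Int(1)[OF sp2 Z'(1) tX2(1)] Z'(2) X(2) by blast
    then have "tight en B2 (Z' \<union> X \<union> Y)"
      using tight_Un_Int(1)[OF sp2 _ tX2(2)] Z'(2) Y(2) by blast
    moreover have "card (inside en B2 (Z' \<union> X \<union> Y)) = card (inside en B (Z' \<union> X \<union> Y))"
      by (rule cB2) auto
    ultimately have "tight en B (Z' \<union> X \<union> Y)" by (simp add: tight_def)
    then have "Z \<subseteq> Z' \<union> X \<union> Y" using Z(3) Z'(2) by blast
    then show ?thesis using w by blast
  qed
  have "x \<noteq> w" using w X(2) by blast
  then obtain e' where e': "e' \<in> B2" "en e' \<subseteq> Z'" "w \<in> en e'"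
    using tight_edge_at[OF sp2 Z'(1) wZ', of x] Z'(2) by blast
  have Z'K: "Z' \<subseteq> K" using Z'(3)[OF tK2 xyK] .
  define B3 where "B3 = insert e (B2 - {e'})"
  have xy2: "card (en e) = 2" using e X(2) Y(2) XY by (cases "x = y") auto
  have sp3: "sparse en B3"
    unfolding B3_def
  proof (rule sparse_exchange[OF sp2 eB2 xy2 e'(1)])
    fix W assume "tight en B2 W" "en e \<subseteq> W"
    then show "en e' \<subseteq> W" using Z'(3) e(2) e'(2) by blast
  qed
  \<comment> \<open>\<open>B3\<close> agrees with \<open>B\<close> away from \<open>K\<close>, so
    its trace inside \<open>K\<close> is the substitute that turns \<open>B\<close> into
    \<open>B3\<close>.\<close>
  define F where "F = inside en B3 K"
  have eK: "en e \<subseteq> K" "en e' \<subseteq> K" using xyK e e'(2) Z'K by auto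
  have rep: "replace_inside en B K F = B3"
  proof -
    have "B3 - inside en B3 K = B - inside en B K"
    proof -
      have "B3 - inside en B3 K = B2 - inside en B2 K" using eK eB2 by (auto simp: B3_def inside_def)
      also have "\<dots> = B1 - inside en B1 K"
        using Y(5) KX(2) by (auto simp: B2_def replace_inside_def inside_def)
      also have "\<dots> = B - inside en B K"
        using X(5) KX(1) by (auto simp: B1_def replace_inside_def inside_def)
      finally show ?thesis .
    qed
    then show ?thesis by (auto simp: replace_inside_def F_def inside_def)
  qed
  have finB2: "finite B2" using sp2 by (rule sparse_finite)
  have "card F = card (inside en B2 K)"
  proof -
    have "card (inside en B3 K) = Suc (card (inside en (B2 - {e'}) K))"
      unfolding B3_def using card_inside_insert_ends[of "B2 - {e'}" e en K] finB2 eB2 eK by simp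
    also have "\<dots> = card (inside en (insert e' (B2 - {e'})) K)"
      using card_inside_insert_ends[of "B2 - {e'}" e' en K] finB2 eK by simp
    also have "insert e' (B2 - {e'}) = B2" using e' by blast
    finally show ?thesis by (simp add: F_def)
  qed
  then have cF: "card F + 2 = 2 * card K" using tK2 by (simp add: tight_def)
  have le3: "deg en B3 v \<le> deg en B2 v + (if v \<in> {x, y} then 1 else 0)" for v
  proof -
    have "deg en B3 v \<le> deg en (B2 - {e'}) v + (if v \<in> {x, y} then 1 else 0)"
      unfolding B3_def using deg_insert_le[of "B2 - {e'}" en e v] finB2 e(2) by simp
    then show ?thesis using deg_mono[OF finB2, of "B2 - {e'}" en v] by (smt (verit) Diff_subset add_mono le_trans order_refl)
  qed
  \<comment> \<open>Only \<open>x\<close> and \<open>y\<close> can gain degree, by one from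
    \<open>e\<close>, and both were below their bounds after freeing.\<close>
  have "deg en B3 v \<le> g v" if v: "v \<in> X \<union> Y" for v
  proof (cases "v \<in> X")
    case True
    then have "v \<notin> Y" using XY by blast
    then show ?thesis
      using le3[of v] degX[of v] X(7)[OF True] X(8) Y(2) by (auto split: if_splits)
  next
    case False
    then have "v \<in> Y" using v by blast
    then show ?thesis
      using le3[of v] degY[of v] Y(7)[of v] Y(8) X(2) False by (auto split: if_splits)
  qed
  moreover have "deg en B3 v \<le> deg en B v" if v: "v \<notin> X \<union> Y" for v
    using le3[of v] degO[OF v] v X(2) Y(2) by (auto split: if_splits)
  moreover have "deg en B3 w < deg en B w"
  proof -
    have "deg en B3 w \<le> deg en (B2 - {e'}) w"
    proof -
      have "w \<notin> en e" using e(2) w(2) X(2) Y(2) by auto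
      then show ?thesis
        unfolding B3_def using deg_insert_le[of "B2 - {e'}" en e w] finB2 by simp
    qed
    also have "\<dots> < deg en B2 w" using deg_remove[OF finB2 e'(1)] e'(3) by metis
    finally show ?thesis using degO[OF w(2)] by simp
  qed
  moreover have "sparse en F" using sp3 by (rule sparse_subset) (auto simp: F_def inside_def)
  moreover have "F \<subseteq> E" using B2E e(1) by (auto simp: F_def B3_def inside_def)
  moreover have "\<forall>e\<in>F. en e \<subseteq> K" by (auto simp: F_def inside_def)
  ultimately show "\<exists>F. sparse en F \<and> F \<subseteq> E \<and> (\<forall>e\<in>F. en e \<subseteq> K) \<and> card F + 2 = 2 * card K \<and>
      (\<forall>v\<in>X \<union> Y. deg en (replace_inside en B K F) v \<le> g v) \<and>
      (\<forall>v. v \<notin> X \<union> Y \<longrightarrow> deg en (replace_inside en B K F) v \<le> deg en B v) \<and>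
      deg en (replace_inside en B K F) w < deg en B w"
    using cF rep by blast
qed

section \<open>The extremal argument for bounded degrees\<close>

lemma exists_sparse_spanning_bounded_degrees:
  fixes G :: "('a, 'b) mgraph" and g :: "'a \<Rightarrow> nat"
  assumes G: "multigraph G" and ne: "verts G \<noteq> {}"
    and hyp: "\<And>S. S \<subseteq> verts G \<Longrightarrow>
      Omega 2 (delete_verts G S) \<le> (\<Sum>v\<in>S. int (g v) - 4) + 2 + Omega 2 (induced G S)"
  shows "\<exists>B\<subseteq>edges G. sparse (ends G) B \<and> tight (ends G) B (verts G) \<and>
    (\<forall>v\<in>verts G. deg (ends G) B v \<le> g v)"
proof -
  let ?en = "ends G" and ?E = "edges G" and ?V = "verts G"
  have finV: "finite ?V" and finE: "finite ?E"
    and endsE: "\<And>e. e \<in> ?E \<Longrightarrow> ?en e \<subseteq> ?V \<and> card (?en e) = 2"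
    using G by (auto simp: multigraph_def)
  define base where "base = (\<lambda>B. B \<subseteq> ?E \<and> sparse ?en B \<and> tight ?en B ?V)"
  \<comment> \<open>Truncated subtraction makes vertices below their bound contribute 0.\<close>
  define excess where "excess = (\<lambda>B. \<Sum>v\<in>?V. deg ?en B v - g v)"
  have "Omega 2 (induced G {}) \<le> 0"
    using Omega_induced_le[OF G, of "{}" "{}"] by (simp add: sparse_empty inside_def)
  then have "Omega 2 (induced G ?V) \<le> 2"
    using hyp[of "{}"] by (simp add: delete_verts_def)
  then obtain B0 where "base B0"
    using exists_sparse_spanning[OF G ne] by (auto simp: base_def)
  then obtain B where "base B" and min: "\<And>B'. base B' \<Longrightarrow> excess B \<le> excess B'"
    using ex_has_least_nat[of base B0 excess] by blast
  then have B: "B \<subseteq> ?E" "sparse ?en B" "tight ?en B ?V" by (auto simp: base_def)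
  have finB: "finite B" using B(2) by (rule sparse_finite)
  have "deg ?en B v \<le> g v" if "v \<in> ?V" for v
  proof (rule ccontr)
    assume over: "\<not> ?thesis"
    define good where "good = (\<lambda>U. U \<subseteq> ?V \<and> (\<forall>v\<in>U. deg ?en B v \<le> g v) \<and>
      (\<forall>w\<in>U. \<exists>X\<subseteq>U. \<exists>F. frees ?en g ?E B w X F))"
    have "good {}" by (simp add: good_def)
    moreover have "finite {U. good U}"
      by (rule finite_subset[of _ "Pow ?V"]) (auto simp: good_def finV)
    ultimately obtain U where "U \<in> {U. good U}" and max: "\<forall>U'\<in>{U. good U}. U \<subseteq> U' \<longrightarrow> U = U'"
      using finite_has_maximal2[of "{U. good U}" "{}"] by blast
    have maxU: "U' \<subseteq> U" if "good (U \<union> U')" for U'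
    proof -
      have "U = U \<union> U'" using max[THEN bspec, of "U \<union> U'"] that by simp
      then show ?thesis by blast
    qed
    have U: "U \<subseteq> ?V" "\<And>v. v \<in> U \<Longrightarrow> deg ?en B v \<le> g v"
        "\<And>w. w \<in> U \<Longrightarrow> \<exists>X\<subseteq>U. \<exists>F. frees ?en g ?E B w X F"
      using \<open>U \<in> {U. good U}\<close> by (simp_all add: good_def)
    \<comment> \<open>A vertex below its bound is freed by the tight set \<open>{w}\<close> with the
      empty substitute, so maximality puts it into \<open>U\<close>.\<close>
    have sat: "g w \<le> deg ?en B w" if w: "w \<in> ?V - U" for w
    proof (rule ccontr)
      assume low: "\<not> ?thesis"
      have t: "tight ?en B {w}" using sparse_card_ends[OF B(2)] by (intro tight_singleton) auto
      then have "inside ?en B {w} = {}"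
        using finite_inside[OF finB, of ?en "{w}"] by (simp add: tight_def)
      then have "replace_inside ?en B {w} {} = B" by (simp add: replace_inside_def)
      then have "frees ?en g ?E B w {w} {}"
        using t low sparse_empty[of ?en] by (simp add: frees_def)
      then have "\<exists>X\<subseteq>U \<union> {w}. \<exists>F. frees ?en g ?E B w X F" by blast
      moreover have "\<exists>X\<subseteq>U \<union> {w}. \<exists>F. frees ?en g ?E B u X F" if "u \<in> U" for u
        using U(3)[OF that] by blast
      ultimately have "good (U \<union> {w})"
        using U(1,2) w low by (auto simp: good_def)
      then have "w \<in> U" using maxU[of "{w}"] by blast
      then show False using w by blast
    qed
    have span: "\<exists>Z\<subseteq>U. tight ?en B Z \<and> ?en e \<subseteq> Z" if e: "e \<in> ?E - B" "?en e \<subseteq> U" for e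
    proof -
      have "card (?en e) = 2" using endsE e by blast
      then obtain x y where xy: "?en e = {x, y}" "x \<noteq> y" by (meson card_2_iff)
      obtain X FX where X: "X \<subseteq> U" "frees ?en g ?E B x X FX" using U(3)[of x] e(2) xy by auto
      obtain Y FY where Y: "Y \<subseteq> U" "frees ?en g ?E B y Y FY" using U(3)[of y] e(2) xy by auto
      have tXY: "tight ?en B X" "tight ?en B Y" "x \<in> X" "y \<in> Y" using X Y by (auto simp: frees_def)
      show ?thesis
      \<comment> \<open>If the freeing sets meet, their union is a tight subset of \<open>U\<close>
        that spans \<open>e\<close>. Otherwise they can be used independently.\<close>
      proof (cases "X \<inter> Y = {}")
        case False
        then have "tight ?en B (X \<union> Y)" using tight_Un_Int(1)[OF B(2) tXY(1,2)] by blast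
        then show ?thesis using X(1) Y(1) tXY(3,4) xy by (intro exI[of _ "X \<union> Y"]) auto
      next
        case True
        have "{x, y} \<subseteq> ?V" using endsE[of e] e xy by auto
        then obtain Z where Z: "tight ?en B Z" "{x, y} \<subseteq> Z"
            "\<And>W. tight ?en B W \<Longrightarrow> {x, y} \<subseteq> W \<Longrightarrow> Z \<subseteq> W"
          using exists_least_tight[OF B(2,3), of "{x, y}"] by blast
        have ZV: "Z \<subseteq> ?V" using Z(3)[OF B(3)] \<open>{x, y} \<subseteq> ?V\<close> by blast
        define K where "K = Z \<union> X \<union> Y"
        have KV: "K \<subseteq> ?V" using ZV X(1) Y(1) U(1) by (auto simp: K_def)
        have key: "tight ?en B K \<and> deg ?en B w \<le> g w \<and>
            (\<exists>F. sparse ?en F \<and> F \<subseteq> ?E \<and> (\<forall>e\<in>F. ?en e \<subseteq> K) \<and> card F + 2 = 2 * card K \<and>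
              (\<forall>v\<in>X \<union> Y. deg ?en (replace_inside ?en B K F) v \<le> g v) \<and>
              (\<forall>v. v \<notin> X \<union> Y \<longrightarrow> deg ?en (replace_inside ?en B K F) v \<le> deg ?en B v) \<and>
              deg ?en (replace_inside ?en B K F) w < deg ?en B w)"
          if w: "w \<in> Z" "w \<notin> U" for w
        proof -
          have wXY: "w \<notin> X \<union> Y" using w X(1) Y(1) by blast
          have tK: "tight ?en B K"
            unfolding K_def
            using exchange_after_freeing(1)[OF B(2,1) e(1) xy(1) X(2) Y(2) True Z w(1) wXY] .
          obtain F where F: "sparse ?en F" "F \<subseteq> ?E" "\<forall>e\<in>F. ?en e \<subseteq> K" "card F + 2 = 2 * card K"
              "\<forall>v\<in>X \<union> Y. deg ?en (replace_inside ?en B K F) v \<le> g v"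
              "\<forall>v. v \<notin> X \<union> Y \<longrightarrow> deg ?en (replace_inside ?en B K F) v \<le> deg ?en B v"
              "deg ?en (replace_inside ?en B K F) w < deg ?en B w"
            using exchange_after_freeing(2)[OF B(2,1) e(1) xy(1) X(2) Y(2) True Z w(1) wXY]
            unfolding K_def[symmetric] by blast
          let ?B' = "replace_inside ?en B K F"
          have "sparse ?en ?B'" using sparse_replace[OF B(2) tK F(1,3,4)] .
          moreover have "tight ?en ?B' ?V"
            using card_inside_replace[OF B(2) tK sparse_finite[OF F(1)] F(3,4) KV] B(3)
            by (simp add: tight_def)
          moreover have "?B' \<subseteq> ?E" using B(1) F(2) by (auto simp: replace_inside_def)
          ultimately have le: "excess B \<le> excess ?B'" using min by (simp add: base_def)
          \<comment> \<open>If \<open>w\<close> were overloaded, the exchange would lower its excess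
            without raising that of any other vertex, against the choice of
            \<open>B\<close>.\<close>
          have "deg ?en B w \<le> g w"
          proof (rule ccontr)
            assume "\<not> ?thesis"
            then have "deg ?en ?B' w - g w < deg ?en B w - g w" using F(7) by simp
            moreover have "deg ?en ?B' v - g v \<le> deg ?en B v - g v" for v
              using F(5,6) by (cases "v \<in> X \<union> Y") (auto intro: diff_le_mono)
            moreover have "w \<in> ?V" using w ZV by blast
            ultimately have "excess ?B' < excess B"
              unfolding excess_def using finV by (intro sum_strict_mono_ex1) auto
            then show False using le by simp
          qed
          then show ?thesis using tK F by blast
        qed
        have degK: "deg ?en B v \<le> g v" if "v \<in> K" for v
          using that key[of v] U(2)[of v] X(1) Y(1) by (auto simp: K_def)
        \<comment> \<open>Each vertex of \<open>K\<close> outside \<open>U\<close> lies in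
          \<open>Z\<close> and is freed by its own exchange inside \<open>K\<close>. Maximality then
          gives \<open>Z \<subseteq> U\<close>, which is what \<open>span\<close> asks for.\<close>
        have "good (U \<union> K)"
          unfolding good_def
        proof (intro conjI ballI)
          show "U \<union> K \<subseteq> ?V" using U(1) KV by blast
          show "deg ?en B v \<le> g v" if "v \<in> U \<union> K" for v using that U(2) degK by blast
          fix w assume w: "w \<in> U \<union> K"
          show "\<exists>X\<subseteq>U \<union> K. \<exists>F. frees ?en g ?E B w X F"
          proof (cases "w \<in> U")
            case True
            then show ?thesis using U(3)[of w] by blast
          next
            case False
            then have wZ: "w \<in> Z" using w X(1) Y(1) by (auto simp: K_def)
            obtain F where F: "sparse ?en F" "F \<subseteq> ?E" "\<forall>e\<in>F. ?en e \<subseteq> K" "card F + 2 = 2 * card K"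
                "\<forall>v\<in>X \<union> Y. deg ?en (replace_inside ?en B K F) v \<le> g v"
                "\<forall>v. v \<notin> X \<union> Y \<longrightarrow> deg ?en (replace_inside ?en B K F) v \<le> deg ?en B v"
                "deg ?en (replace_inside ?en B K F) w < deg ?en B w"
              and tK: "tight ?en B K" "deg ?en B w \<le> g w"
              using key[OF wZ False] by blast
            have "deg ?en (replace_inside ?en B K F) v \<le> g v" if "v \<in> K" for v
              using F(5,6) degK[OF that] by (cases "v \<in> X \<union> Y") (auto intro: le_trans)
            then have "frees ?en g ?E B w K F"
              using F tK wZ by (auto simp: frees_def K_def)
            then show ?thesis by blast
          qed
        qed
        then have "K \<subseteq> U" by (rule maxU)
        then show ?thesis using Z xy by (intro exI[of _ Z]) (auto simp: K_def)
      qed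
    qed
    define S where "S = ?V - U"
    have S: "S \<subseteq> ?V" "finite S" "?V - S = U" using U(1) finV by (auto simp: S_def)
    have cV: "card ?V = card S + card U"
      using U(1) finV by (simp add: S_def card_Diff_subset finite_subset card_mono)
    have "inside ?en B ?V = B" using B(1) endsE by (auto simp: inside_def)
    then have cB: "card B + 2 = 2 * card ?V" using B(3) by (simp add: tight_def)
    have "(\<Sum>v\<in>S. deg ?en B v) + card (inside ?en B U) = card B + card (inside ?en B S)"
      using sum_deg[OF finB S(2,1), of ?en] B(1) endsE S(3) by auto
    \<comment> \<open>Every vertex of \<open>S\<close> is saturated, and the overloaded vertex,
      being outside \<open>U\<close>, makes the inequality strict.\<close>
    moreover have "(\<Sum>v\<in>S. g v) < (\<Sum>v\<in>S. deg ?en B v)"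
    proof (rule sum_strict_mono_ex1[OF S(2)])
      show "\<forall>v\<in>S. g v \<le> deg ?en B v" using sat by (simp add: S_def)
      have "v \<notin> U" using over U(2) by blast
      then show "\<exists>v\<in>S. g v < deg ?en B v" using over that by (intro bexI[of _ v]) (auto simp: S_def)
    qed
    moreover have "2 * int (card U) - int (card (inside ?en B U)) \<le> Omega 2 (delete_verts G S)"
      using Omega_induced_ge[OF G U(1) B(2,1) span] S(3) by (simp add: delete_verts_def)
    moreover have "Omega 2 (induced G S) \<le> 2 * int (card S) - int (card (inside ?en B S))"
      using Omega_induced_le[OF G S(1) B(2,1)] .
    moreover have "(\<Sum>v\<in>S. int (g v) - 4) = int (\<Sum>v\<in>S. g v) - 4 * int (card S)"
      by (simp add: sum_subtractf)
    \<comment> \<open>Since \<open>card B = 2 * card ?V - 2\<close>, the degree sum over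
      \<open>S\<close> is at most \<open>Omega 2 (delete_verts G S) - Omega 2 (induced G S) + 4 *
      card S - 2\<close>. By the hypothesis for \<open>S\<close> this is at most the sum of
      \<open>g\<close> over \<open>S\<close>, against strictness.\<close>
    ultimately show False using hyp[OF S(1)] cB cV by linarith
  qed
  then show ?thesis using B by blast
qed

subsection \<open>Eulerian trails\<close>

definition odd_at :: "('b \<Rightarrow> 'a set) \<Rightarrow> 'b set \<Rightarrow> 'a \<Rightarrow> bool" where
  "odd_at en F v \<longleftrightarrow> odd (deg en F v)"

lemma odd_at_sym_diff:
  assumes "finite A" "finite B"
  shows "odd_at en (sym_diff A B) v \<longleftrightarrow> odd_at en A v \<noteq> odd_at en B v"
proof -
  let ?A = "{e \<in> A. v \<in> en e}" and ?B = "{e \<in> B. v \<in> en e}"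
  have "{e \<in> sym_diff A B. v \<in> en e} = (?A - ?B) \<union> (?B - ?A)" by auto
  moreover have "card ((?A - ?B) \<union> (?B - ?A)) = card (?A - ?B) + card (?B - ?A)"
    using assms by (intro card_Un_disjoint) auto
  moreover have "card ?A = card (?A - ?B) + card (?A \<inter> ?B)"
    using assms by (subst card_Un_disjoint[symmetric]) (auto intro: arg_cong[of _ _ card])
  moreover have "card ?B = card (?B - ?A) + card (?A \<inter> ?B)"
    using assms by (subst card_Un_disjoint[symmetric]) (auto intro: arg_cong[of _ _ card])
  ultimately show ?thesis unfolding odd_at_def deg_def by presburger
qed

lemma odd_at_single:
  "odd_at en {e} v \<longleftrightarrow> v \<in> en e"
proof -
  have "{e' \<in> {e}. v \<in> en e'} = (if v \<in> en e then {e} else {})" by auto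
  then show ?thesis by (simp add: odd_at_def deg_def)
qed

text \<open>The vertices \<open>v\<close> for which such a \<open>J\<close> exists include
  \<open>u\<close>, by the empty set, and cannot be left along an edge of \<open>T\<close>: toggling
  the edge in \<open>J\<close> moves the odd end across it.\<close>

lemma linked_join_pair:
  assumes T: "linked en T V" "finite T" "\<forall>e\<in>T. card (en e) = 2" and u: "u \<in> V" and v: "v \<in> V"
  shows "\<exists>J\<subseteq>T. \<forall>w. odd_at en J w \<longleftrightarrow> (w = u) \<noteq> (w = v)"
proof -
  define R where "R = {v \<in> V. \<exists>J\<subseteq>T. \<forall>w. odd_at en J w \<longleftrightarrow> (w = u) \<noteq> (w = v)}"
  have "u \<in> R" using u by (auto simp: R_def odd_at_def deg_def intro!: exI[of _ "{}"])
  have "R = V"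
  proof (rule ccontr)
    assume "R \<noteq> V"
    moreover have "R \<subseteq> V" by (auto simp: R_def)
    moreover have "R \<noteq> {}" using \<open>u \<in> R\<close> by blast
    ultimately obtain e x y where e: "e \<in> T" "x \<in> en e" "x \<in> R" "y \<in> en e" "y \<in> V" "y \<notin> R"
      using linkedE[OF T(1)] by metis
    have "card (en e) = 2" using T(3) e(1) by blast
    then obtain z where "en e = {x, z}" "z \<noteq> x" using e(2) by (rule other_end)
    moreover have "y \<noteq> x" using e by blast
    ultimately have ee: "en e = {x, y}" using e(4) by auto
    obtain J where J: "J \<subseteq> T" "\<And>w. odd_at en J w \<longleftrightarrow> (w = u) \<noteq> (w = x)" using e(3) by (auto simp: R_def)
    have "finite J" using J(1) T(2) finite_subset by blast
    then have "odd_at en (sym_diff J {e}) w \<longleftrightarrow> (w = u) \<noteq> (w = y)" for w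
      using J(2)[of w] ee \<open>y \<noteq> x\<close> by (auto simp: odd_at_sym_diff odd_at_single)
    moreover have "sym_diff J {e} \<subseteq> T" using J(1) e(1) by blast
    ultimately have "y \<in> R" using e(5) unfolding R_def by blast
    then show False using e(6) by blast
  qed
  then show ?thesis using v by (auto simp: R_def)
qed

text \<open>The symmetric difference, over all edges of \<open>F\<close>, of joins between their two
  ends has the same odd vertices as \<open>F\<close>.\<close>

lemma linked_join:
  assumes T: "linked en T V" "finite T" "\<forall>e\<in>T. card (en e) = 2"
    and F: "finite F" "\<forall>e\<in>F. card (en e) = 2 \<and> en e \<subseteq> V"
  shows "\<exists>J\<subseteq>T. \<forall>w. odd_at en J w \<longleftrightarrow> odd_at en F w"
  using F
proof (induction F rule: finite_induct)
  case empty
  then show ?case by blast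
next
  case (insert e F)
  then obtain J where J: "J \<subseteq> T" "\<And>w. odd_at en J w \<longleftrightarrow> odd_at en F w" by auto
  have "card (en e) = 2" using insert.prems by blast
  then obtain u v where uv: "en e = {u, v}" "u \<noteq> v" by (meson card_2_iff)
  have "u \<in> V" "v \<in> V" using insert.prems uv by auto
  then obtain K where K: "K \<subseteq> T" "\<forall>w. odd_at en K w \<longleftrightarrow> (w = u) \<noteq> (w = v)"
    using linked_join_pair[OF T, of u v] by blast
  have fin: "finite J" "finite K" using finite_subset[OF _ T(2)] J(1) K(1) by auto
  have eq: "insert e F = sym_diff F {e}" using insert.hyps by blast
  have "odd_at en (insert e F) w \<longleftrightarrow> odd_at en F w \<noteq> (w \<in> en e)" for w
    unfolding eq odd_at_sym_diff[OF insert.hyps(1) finite.insertI[OF finite.emptyI]] odd_at_single ..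
  moreover have "odd_at en (sym_diff J K) w \<longleftrightarrow> odd_at en J w \<noteq> odd_at en K w" for w
    using fin by (rule odd_at_sym_diff)
  ultimately have "odd_at en (sym_diff J K) w \<longleftrightarrow> odd_at en (insert e F) w" for w
    using J(2)[of w] K(2) uv by auto
  moreover have "sym_diff J K \<subseteq> T" using J(1) K(1) by blast
  ultimately show ?case by blast
qed

text \<open>\<open>T2\<close> contains a set with the same odd vertices as \<open>T1\<close>. As it
  is disjoint from \<open>T1\<close>, parities cancel in the union, which \<open>T1\<close> keeps
  linked.\<close>

lemma even_spanning_subgraph:
  assumes B: "finite B" "\<forall>e\<in>B. card (en e) = 2 \<and> en e \<subseteq> V"
    and T: "T1 \<subseteq> B" "T2 \<subseteq> B" "T1 \<inter> T2 = {}" "linked en T1 V" "linked en T2 V"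
  shows "\<exists>A\<subseteq>B. linked en A V \<and> (\<forall>v. even (deg en A v))"
proof -
  have fin: "finite T1" "finite T2" using T B(1) finite_subset by blast+
  obtain J where J: "J \<subseteq> T2" "\<And>w. odd_at en J w \<longleftrightarrow> odd_at en T1 w"
    using linked_join[OF T(5) fin(2) _ fin(1)] T(1,2) B(2) by blast
  have "finite J" using J(1) fin(2) finite_subset by blast
  then have "\<not> odd_at en (sym_diff T1 J) v" for v
    using odd_at_sym_diff[OF fin(1), of J en v] J(2)[of v] by blast
  moreover have "sym_diff T1 J = T1 \<union> J" using J(1) T(3) by blast
  ultimately have "even (deg en (T1 \<union> J) v)" for v by (simp add: odd_at_def)
  moreover have "linked en (T1 \<union> J) V" using T(4) by (rule linked_mono) blast
  ultimately show ?thesis using J(1) T(1,2) by (intro exI[of _ "T1 \<union> J"]) auto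
qed

text \<open>The vertex list of a trail omits its first vertex, in accordance with \<open>visits\<close>.\<close>

inductive trail :: "('b \<Rightarrow> 'a set) \<Rightarrow> 'b set \<Rightarrow> 'a \<Rightarrow> 'b list \<Rightarrow> 'a list \<Rightarrow> 'a \<Rightarrow> bool" for en A where
  Nil: "trail en A u [] [] u"
| Cons: "e \<in> A \<Longrightarrow> en e = {u, x} \<Longrightarrow> u \<noteq> x \<Longrightarrow> trail en A x es xs w \<Longrightarrow> trail en A u (e # es) (x # xs) w"

lemma trail_append:
  "trail en A u es xs w \<Longrightarrow> trail en A w es' xs' z \<Longrightarrow> trail en A u (es @ es') (xs @ xs') z"
proof (induction rule: trail.induct)
  case (Cons e u x es xs w)
  then show ?case using trail.Cons[where en = en, OF Cons.hyps(1-3)] by simp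
qed simp

text \<open>Used to rotate a closed trail so that it starts and ends at a chosen vertex.\<close>

lemma trail_split:
  "trail en A u es zs w \<Longrightarrow> x \<in> set zs \<Longrightarrow>
    \<exists>es1 es2 zs1 zs2. es = es1 @ es2 \<and> zs = zs1 @ zs2 \<and> trail en A u es1 zs1 x \<and> trail en A x es2 zs2 w"
proof (induction rule: trail.induct)
  case (Cons e u y es xs w)
  show ?case
  proof (cases "x = y")
    case True
    have "trail en A u [e] [y] y" using trail.Cons[where en = en, OF Cons.hyps(1-3) trail.Nil] .
    then show ?thesis
      using Cons.hyps(4) True
      by (intro exI[of _ "[e]"] exI[of _ es] exI[of _ "[y]"] exI[of _ xs]) simp
  next
    case False
    then obtain es1 es2 zs1 zs2 where s: "es = es1 @ es2" "xs = zs1 @ zs2"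
        "trail en A y es1 zs1 x" "trail en A x es2 zs2 w"
      using Cons.IH Cons.prems by auto
    then show ?thesis
      using trail.Cons[where en = en, OF Cons.hyps(1-3) s(3)]
      by (intro exI[of _ "e # es1"] exI[of _ es2] exI[of _ "y # zs1"] exI[of _ zs2]) simp
  qed
qed simp

lemma trail_edges: "trail en A u es xs w \<Longrightarrow> set es \<subseteq> A"
  by (induction rule: trail.induct) auto

lemma trail_ends: "trail en A u es xs w \<Longrightarrow> e \<in> set es \<Longrightarrow> en e \<subseteq> insert u (set xs)"
  by (induction rule: trail.induct) auto

text \<open>Every listed visit has an entering and a leaving edge, except that nothing leaves the
  final visit at \<open>w\<close>; the start \<open>u\<close> has an unlisted leaving edge. Both
  corrections are written as additions.\<close>

lemma deg_trail:
  assumes "trail en A u es xs w" "distinct es"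
  shows "deg en (set es) v + (if v = w then 1 else 0) = 2 * count_list xs v + (if v = u then 1 else 0)"
  using assms
proof (induction rule: trail.induct)
  case (Nil u)
  then show ?case by (simp add: deg_def)
next
  case (Cons e u x es xs w)
  have "{e' \<in> set (e # es). v \<in> en e'} =
      (if v \<in> {u, x} then insert e {e' \<in> set es. v \<in> en e'} else {e' \<in> set es. v \<in> en e'})"
    using Cons.hyps(2) by auto
  then have "deg en (set (e # es)) v = deg en (set es) v + (if v \<in> {u, x} then 1 else 0)"
    using Cons.prems by (simp add: deg_def)
  then show ?case using Cons by (auto split: if_splits)
qed

lemma walk_trail:
  assumes "trail (ends G) A u es xs w" "A \<subseteq> edges G" "\<forall>e\<in>A. ends G e \<subseteq> verts G" "u \<in> verts G"
  shows "walk G (u # xs) es \<and> last (u # xs) = w"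
  using assms
proof (induction rule: trail.induct)
  case (Nil u)
  then show ?case by (simp add: walk_def)
next
  case (Cons e u x es xs w)
  then have "x \<in> verts G" by fastforce
  then have IH: "walk G (x # xs) es \<and> last (x # xs) = w" using Cons by blast
  have "ends G ((e # es) ! i) = {(u # x # xs) ! i, (u # x # xs) ! Suc i}" if "i < length (e # es)" for i
    using that IH Cons.hyps(2) by (cases i) (auto simp: walk_def)
  then show ?case using IH Cons by (auto simp: walk_def)
qed

lemma eulerian_closed_trail:
  assumes A: "finite A" "\<forall>e\<in>A. card (en e) = 2 \<and> en e \<subseteq> V" "linked en A V"
    and even: "\<And>v. even (deg en A v)" and u0: "u0 \<in> V"
  shows "\<exists>u es xs. u \<in> V \<and> trail en A u es xs u \<and> distinct es \<and> set es = A \<and>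
    insert u (set xs) = V"
proof -
  \<comment> \<open>A longest trail is taken among all trails with distinct edges and arbitrary
    starting vertex; the number of edges of \<open>A\<close> bounds its length.\<close>
  define P where "P = (\<lambda>n. \<exists>u es xs w. u \<in> V \<and> trail en A u es xs w \<and> distinct es \<and> length es = n)"
  have bound: "n \<le> card A" if "P n" for n
    using that trail_edges[of en A] A(1) unfolding P_def
    by (metis card_mono distinct_card)
  have "P 0" using u0 trail.Nil[of en A u0] unfolding P_def by (metis distinct.simps(1) list.size(3))
  then have "P (Greatest P)" and max: "\<And>n. P n \<Longrightarrow> n \<le> Greatest P"
    using bound by (auto intro: GreatestI_nat Greatest_le_nat)
  then obtain u es xs w where t: "u \<in> V" "trail en A u es xs w" "distinct es" "length es = Greatest P"
    unfolding P_def by blast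
  have sub: "set es \<subseteq> A" using trail_edges[OF t(2)] .
  have no_ext: "e \<in> set fs" if tr: "trail en A x fs ys z" "distinct fs" "length fs = Greatest P" "x \<in> V"
      and e: "e \<in> A" "z \<in> en e" for x fs ys z e
  proof (rule ccontr)
    assume "e \<notin> set fs"
    have "card (en e) = 2" using A(2) e(1) by blast
    then obtain y where y: "en e = {z, y}" "y \<noteq> z" using e(2) by (rule other_end)
    then have "trail en A z [e] [y] y" using trail.Cons[where en = en, OF e(1) y(1) _ trail.Nil] by blast
    then have "trail en A x (fs @ [e]) (ys @ [y]) y" by (rule trail_append[OF tr(1)])
    moreover have "distinct (fs @ [e])" using tr(2) \<open>e \<notin> set fs\<close> by simp
    moreover have "length (fs @ [e]) = Suc (Greatest P)" using tr(3) by simp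
    ultimately have "P (Suc (Greatest P))" using tr(4) unfolding P_def by blast
    then show False using max[of "Suc (Greatest P)"] by simp
  qed
  \<comment> \<open>By maximality the trail uses all edges at its end \<open>w\<close>. If it were
    open, the number of its edges at \<open>w\<close> would be odd.\<close>
  have closed: "w = u"
  proof (rule ccontr)
    assume "w \<noteq> u"
    have "{e \<in> A. w \<in> en e} = {e \<in> set es. w \<in> en e}"
      using no_ext[OF t(2,3,4,1)] sub by blast
    then have "deg en (set es) w = deg en A w" by (simp add: deg_def)
    then show False using deg_trail[OF t(2,3), of w] even[of w] \<open>w \<noteq> u\<close> by presburger
  qed
  have all: "e \<in> set es" if e: "e \<in> A" "en e \<inter> insert u (set xs) \<noteq> {}" for e
  proof -
    obtain z where z: "z \<in> en e" "z \<in> insert u (set xs)" using e(2) by blast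
    show ?thesis
    proof (cases "z = u")
      case True
      then show ?thesis using no_ext[OF t(2,3,4,1) e(1)] closed z(1) by blast
    next
      case False
      then obtain es1 es2 zs1 zs2 where s: "es = es1 @ es2" "trail en A u es1 zs1 z" "trail en A z es2 zs2 w"
        using trail_split[OF t(2), of z] z(2) by blast
      have "trail en A z (es2 @ es1) (zs2 @ zs1) z" using trail_append[OF s(3)] s(2) closed by blast
      moreover have "distinct (es2 @ es1)" "length (es2 @ es1) = Greatest P" using t(3,4) s(1) by auto
      moreover have "z \<in> V" using A(2) e(1) z(1) by blast
      ultimately have "e \<in> set (es2 @ es1)" using no_ext e(1) z(1) by blast
      then show ?thesis using s(1) by auto
    qed
  qed
  have xsV: "set xs \<subseteq> V"
  proof -
    have "trail en A x fs ys z \<Longrightarrow> set ys \<subseteq> V" for x fs ys z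
      by (induction rule: trail.induct) (use A(2) in auto)
    then show ?thesis using t(2) by blast
  qed
  \<comment> \<open>Otherwise linking provides an edge leaving the visited set; by
    \<open>all\<close> it is on the trail, whose edges have both ends visited.\<close>
  have V: "insert u (set xs) = V"
  proof (rule ccontr)
    assume "insert u (set xs) \<noteq> V"
    moreover have "insert u (set xs) \<subseteq> V" using xsV t(1) by simp
    ultimately obtain e x y where e: "e \<in> A" "x \<in> en e" "x \<in> insert u (set xs)"
        "y \<in> en e" "y \<notin> insert u (set xs)"
      using linkedE[OF A(3) _ insert_not_empty] by metis
    then have "e \<in> set es" using all[of e] by blast
    then have "en e \<subseteq> insert u (set xs)" by (rule trail_ends[OF t(2)])
    then show False using e(4,5) by blast
  qed
  have "e \<in> set es" if "e \<in> A" for e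
  proof (rule all[OF that])
    have "en e \<subseteq> V" "en e \<noteq> {}" using A(2) that by fastforce+
    then show "en e \<inter> insert u (set xs) \<noteq> {}" unfolding V by blast
  qed
  then have "set es = A" using sub by blast
  then show ?thesis using t(1-3) closed V by blast
qed

theorem theorem7p1:
  fixes G :: "('a, 'b) mgraph" and f :: "'a \<Rightarrow> nat"
  assumes "multigraph G" and "verts G \<noteq> {}"
    and "\<forall>v\<in>verts G. f v > 0"
    and "\<forall>S. S \<subseteq> verts G \<longrightarrow>
      1/2 * real_of_int (Omega 2 (delete_verts G S))
        \<le> (\<Sum>v\<in>S. real (f v) - 3/2) + 1 + 1/2 * real_of_int (Omega 2 (induced G S))"
  shows "\<exists>vs es. spanning_closed_trail G vs es \<and> (\<forall>v\<in>verts G. visits vs v \<le> f v)"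
proof -
  let ?en = "ends G" and ?V = "verts G"
  \<comment> \<open>This is the hypothesis doubled, with \<open>g = 2 f + 1\<close> chosen because
    \<open>2 * f v + 1 - 4 = 2 * (f v - 3/2)\<close>.\<close>
  have "Omega 2 (delete_verts G S) \<le> (\<Sum>v\<in>S. int (2 * f v + 1) - 4) + 2 + Omega 2 (induced G S)"
    if "S \<subseteq> ?V" for S
  proof -
    have "real_of_int (\<Sum>v\<in>S. int (2 * f v + 1) - 4) = 2 * (\<Sum>v\<in>S. real (f v) - 3/2)"
      unfolding sum_distrib_left of_int_sum by (rule sum.cong) auto
    moreover have "1/2 * real_of_int (Omega 2 (delete_verts G S))
        \<le> (\<Sum>v\<in>S. real (f v) - 3/2) + 1 + 1/2 * real_of_int (Omega 2 (induced G S))"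
      using assms(4) that by blast
    ultimately have "real_of_int (Omega 2 (delete_verts G S)) \<le>
        real_of_int (\<Sum>v\<in>S. int (2 * f v + 1) - 4) + 2 + real_of_int (Omega 2 (induced G S))"
      by linarith
    then show ?thesis by linarith
  qed
  then obtain B where B: "B \<subseteq> edges G" "sparse ?en B" "tight ?en B ?V"
      "\<forall>v\<in>?V. deg ?en B v \<le> 2 * f v + 1"
    using exists_sparse_spanning_bounded_degrees[OF assms(1,2), of "\<lambda>v. 2 * f v + 1"] by blast
  have finB: "finite B" using B(2) by (rule sparse_finite)
  have endsE: "\<forall>e\<in>edges G. card (?en e) = 2 \<and> ?en e \<subseteq> ?V"
    using assms(1) by (simp add: multigraph_def)
  have "inside ?en B ?V \<subseteq> B" by (auto simp: inside_def)
  then obtain T1 T2 where "T1 \<subseteq> B" "T2 \<subseteq> B" "T1 \<inter> T2 = {}" "linked ?en T1 ?V" "linked ?en T2 ?V"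
    using sparse_tight_two_trees[OF B(2,3)] by (meson order_trans)
  moreover have "\<forall>e\<in>B. card (?en e) = 2 \<and> ?en e \<subseteq> ?V" using endsE B(1) by blast
  ultimately obtain A where A: "A \<subseteq> B" "linked ?en A ?V" "\<And>v. even (deg ?en A v)"
    using even_spanning_subgraph[OF finB] by meson
  have AE: "A \<subseteq> edges G" using A(1) B(1) by blast
  have finA: "finite A" using A(1) finB by (rule finite_subset)
  have endsA: "\<forall>e\<in>A. card (?en e) = 2 \<and> ?en e \<subseteq> ?V" using endsE AE by blast
  obtain u0 where "u0 \<in> ?V" using assms(2) by blast
  then obtain u es xs where t: "u \<in> ?V" "trail ?en A u es xs u" "distinct es" "set es = A"
      "insert u (set xs) = ?V"
    using eulerian_closed_trail[OF finA endsA A(2,3)] by blast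
  have "walk G (u # xs) es \<and> last (u # xs) = u"
    using walk_trail[OF t(2) AE _ t(1)] endsA by blast
  then have "spanning_closed_trail G (u # xs) es"
    using t(3,5) by (simp add: spanning_closed_trail_def closed_trail_def)
  moreover have "visits (u # xs) v \<le> f v" if v: "v \<in> ?V" for v
  proof (cases "xs = []")
    \<comment> \<open>The trail is a single vertex and \<open>visits\<close> counts it once;
      positivity of \<open>f\<close> is used here.\<close>
    case True
    then show ?thesis using assms(3) v by (auto simp: visits_def Suc_le_eq)
  next
    case False
    have "2 * count_list xs v = deg ?en A v"
      using deg_trail[OF t(2,3), of v] t(4) by simp
    also have "\<dots> \<le> deg ?en B v" using finB A(1) by (rule deg_mono)
    also have "\<dots> \<le> 2 * f v + 1" using B(4) v by blast
    \<comment> \<open>Twice the number of visits is even, so the bound \<open>2 * f v + 1\<close> is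
      as good as \<open>2 * f v\<close>.\<close>
    finally show ?thesis using False by (simp add: visits_def)
  qed
  ultimately show ?thesis by blast
qed

end
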